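(* Let $K$ be an infinite field, let $R=K[x_1,\dots,x_n]$, let $I\subseteq R$ be a homogeneous ideal, let $p$ be an integer with $0\leq p\leq n$, and let $\operatorname{in}_\tau(I)$ be the initial ideal of $I$ with respect to a term order $\tau$. Let $J$ be an ideal of $R$ generated by $p$ generic linear forms. Then the Hilbert function of $R/(I+J)$ is $\leq$ that of $R/(\operatorname{in}_\tau(I)+J)$, that is, \[ \dim_K [R/(I+J)]_j \;\leq\; \dim_K [R/(\operatorname{in}_\tau(I)+J)]_j \] for all $j\in\mathbf{N}$.
   Context: $R=K[x_1,\dots,x_n]$ has the standard grading, and $[M]_j$ denotes the degree $j$ component of a graded module $M$. A term order is a total order on the monomials of $R$ that is compatible with multiplication and has $1$ as its smallest element. The ideal $\operatorname{in}_\tau(I)$ is generated by the $\tau$-largest monomials of the nonzero elements of $I$. "For $J$ generated by $p$ generic linear forms" means: there is a nonempty Zariski open subset $U$ of $(R_1)^p$ such that the assertion (for all $j$ simultaneously) holds for $J=(y_1,\dots,y_p)$ for every $(y_1,\dots,y_p)\in U$. *)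

theory Defs
  imports
    "HOL-Library.Poly_Mapping"
    "HOL-Library.FuncSet"
    "HOL-Algebra.QuotRing"
    "HOL-Algebra.Embedded_Algebras"
begin

text \<open>
  A monomial is its exponent vector \<open>'v \<Rightarrow>\<^sub>0 nat\<close>, so that multiplication of monomials is addition,
  the monomial \<open>1\<close> is \<open>0\<close>, and a polynomial is a finitely supported map from monomials to the
  coefficients; multiplication in \<open>Poly_Mapping\<close> is convolution.  The polynomial ring is a record
  whose carrier consists of the polynomials involving only variables from \<open>V\<close>; hence
  \<open>mpoly_ring {..<n}\<close> is the polynomial ring in \<open>n\<close> variables, indexed from \<open>0\<close>.
\<close>

type_synonym ('v, 'k) mpol = "('v \<Rightarrow>\<^sub>0 nat) \<Rightarrow>\<^sub>0 'k"

definition monomials :: "'v set \<Rightarrow> ('v \<Rightarrow>\<^sub>0 nat) set" where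
  "monomials V = {m. Poly_Mapping.keys m \<subseteq> V}"

definition mpoly_ring :: "'v set \<Rightarrow> ('v, 'k::field) mpol ring" where
  "mpoly_ring V =
     \<lparr>carrier = {f. Poly_Mapping.keys f \<subseteq> monomials V}, mult = (*), one = 1, zero = 0, add = (+)\<rparr>"

definition mdeg :: "('v \<Rightarrow>\<^sub>0 nat) \<Rightarrow> nat" where
  "mdeg m = (\<Sum>x\<in>Poly_Mapping.keys m. Poly_Mapping.lookup m x)"

definition graded_piece :: "'v set \<Rightarrow> nat \<Rightarrow> ('v, 'k::field) mpol set" where
  "graded_piece V j = {f \<in> carrier (mpoly_ring V). \<forall>m\<in>Poly_Mapping.keys f. mdeg m = j}"

definition homogeneous_ideal :: "'v set \<Rightarrow> ('v, 'k::field) mpol set \<Rightarrow> bool" where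
  "homogeneous_ideal V I \<longleftrightarrow>
     ideal I (mpoly_ring V) \<and>
     (\<exists>S \<subseteq> (\<Union>j. graded_piece V j). I = Idl\<^bsub>mpoly_ring V\<^esub> S)"

text \<open>
  The degree \<open>j\<close> component of \<open>R/A\<close> is the image of that of \<open>R\<close>; its dimension is taken inside the
  quotient ring over the image of the constants.  If \<open>A = R\<close>, these images are both \<open>{0}\<close> and the
  value is \<open>0\<close>.
\<close>

definition hilbert_function :: "'v set \<Rightarrow> ('v, 'k::field) mpol set \<Rightarrow> nat \<Rightarrow> nat" where
  "hilbert_function V A j =
     ring.dim (mpoly_ring V Quot A)
       (range (\<lambda>c. A +>\<^bsub>mpoly_ring V\<^esub> Poly_Mapping.single 0 c))
       ((\<lambda>f. A +>\<^bsub>mpoly_ring V\<^esub> f) ` graded_piece V j)"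

text \<open>In \<open>(a, b) \<in> \<tau>\<close>, the monomial \<open>b\<close> is the larger one.\<close>

definition term_order :: "'v set \<Rightarrow> ('v \<Rightarrow>\<^sub>0 nat) rel \<Rightarrow> bool" where
  "term_order V \<tau> \<longleftrightarrow>
     linear_order_on (monomials V) \<tau> \<and>
     (\<forall>a b. \<forall>c\<in>monomials V. (a, b) \<in> \<tau> \<longrightarrow> (a + c, b + c) \<in> \<tau>) \<and>
     (\<forall>a\<in>monomials V. (0, a) \<in> \<tau>)"

definition is_leading_monomial ::
    "('v \<Rightarrow>\<^sub>0 nat) rel \<Rightarrow> ('v, 'k::field) mpol \<Rightarrow> ('v \<Rightarrow>\<^sub>0 nat) \<Rightarrow> bool" where
  "is_leading_monomial \<tau> f m \<longleftrightarrow>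
     m \<in> Poly_Mapping.keys f \<and> (\<forall>m'\<in>Poly_Mapping.keys f. (m', m) \<in> \<tau>)"

definition initial_ideal ::
    "'v set \<Rightarrow> ('v \<Rightarrow>\<^sub>0 nat) rel \<Rightarrow> ('v, 'k::field) mpol set \<Rightarrow> ('v, 'k) mpol set" where
  "initial_ideal V \<tau> I =
     Idl\<^bsub>mpoly_ring V\<^esub>
       {Poly_Mapping.single m 1 | f m. f \<in> I \<and> f \<noteq> 0 \<and> is_leading_monomial \<tau> f m}"

definition poly_eval :: "('v \<Rightarrow> 'k) \<Rightarrow> ('v, 'k::field) mpol \<Rightarrow> 'k" where
  "poly_eval a F =
     (\<Sum>m\<in>Poly_Mapping.keys F. Poly_Mapping.lookup F m *
        (\<Prod>x\<in>Poly_Mapping.keys m. a x ^ Poly_Mapping.lookup m x))"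

definition linear_form_tuples :: "nat \<Rightarrow> nat \<Rightarrow> (nat \<Rightarrow> (nat, 'k::field) mpol) set" where
  "linear_form_tuples n p = {..<p} \<rightarrow>\<^sub>E graded_piece {..<n} 1"

definition tuple_coord :: "(nat \<Rightarrow> (nat, 'k::field) mpol) \<Rightarrow> nat \<times> nat \<Rightarrow> 'k" where
  "tuple_coord y = (\<lambda>(i, k). Poly_Mapping.lookup (y i) (Poly_Mapping.single k 1))"

text \<open>
  Zariski open subsets of \<open>(R\<^sub>1)\<^sup>p\<close>, identified with affine \<open>p * n\<close>-space through the coefficients
  of the linear forms: complements of the common zero set of a set of polynomials in the coordinates.
\<close>

definition zariski_open :: "nat \<Rightarrow> nat \<Rightarrow> (nat \<Rightarrow> (nat, 'k::field) mpol) set \<Rightarrow> bool" where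
  "zariski_open n p U \<longleftrightarrow>
     (\<exists>S \<subseteq> carrier (mpoly_ring ({..<p} \<times> {..<n}) :: (nat \<times> nat, 'k) mpol ring).
        U = {y \<in> linear_form_tuples n p. \<exists>F\<in>S. poly_eval (tuple_coord y) F \<noteq> 0})"

end

theory Submission
  imports Defs "HOL-Library.Product_Lexorder" "HOL-Computational_Algebra.Polynomial"
begin

text \<open>
  The Hilbert function only depends on leading monomials: in degree \<open>j\<close>, it counts the monomials
  that are not the leading monomial of a form of degree \<open>j\<close> in the ideal
  (\<open>hilbert_function_eq_card_standard_monomials\<close>).  So the claim is that \<open>in(I) + J\<close> has at most as
  many leading monomials in degree \<open>j\<close> as \<open>I + J\<close>.  The two are compared through the generic
  situation: let \<open>u_ik\<close> be parameters, let \<open>Y_i = \<Sum>k. u_ik x_k\<close> be the generic linear forms, and let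
  \<open>M_j\<close> be the \<open>K[u]\<close>-module spanned by the forms of degree \<open>j\<close> in \<open>I\<close> and the products of degree \<open>j\<close>
  of a monomial with some \<open>Y_i\<close> (\<open>generic_module\<close>).

  Leading monomials of \<open>M_j\<close> are leading monomials of \<open>I + J\<close>, for \<open>J\<close> in a nonempty open set that
  works for all \<open>j\<close> (\<open>generic_lead_set_specializes\<close>).  An element of \<open>M_j\<close> keeps its leading monomial
  under \<open>u := y\<close> as long as its leading coefficient, a polynomial in \<open>u\<close>, does not vanish at \<open>y\<close>.  By
  Dickson's lemma finitely many of these elements have leading monomials that divide all others;
  the product of their leading coefficients defines the open set.

  Conversely, \<open>in(I) + J\<close> has at most as many leading monomials in degree \<open>j\<close> as \<open>M_j\<close>, whatever the
  linear forms \<open>y_i\<close> that generate \<open>J\<close> (\<open>card_lead_set_initial_le_generic\<close>).  The degree \<open>j\<close> part of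
  \<open>in(I) + J\<close> has a basis of monomials \<open>x^e\<close>, with \<open>e\<close> a leading monomial of \<open>I\<close>, and of products
  \<open>x^m y_i\<close>.  This basis is deformed in two steps, neither of which creates linear relations.

  \<^item> Replace \<open>y_i\<close> by \<open>Y_i\<close>.  A relation over \<open>K[u]\<close> can be restricted to a line through the point \<open>y\<close>
    and divided by a power of the parameter of the line; its value at \<open>y\<close> is then a relation over \<open>K\<close>
    (\<open>independent_family_of_specialization\<close>).

  \<^item> Replace \<open>x^e\<close> by some \<open>f_e \<in> I\<close> with leading term \<open>x^e\<close>.  Give \<open>u_ik\<close> the multidegree inverse to
    that of \<open>x_k\<close>.  Then \<open>Y_i\<close> has multidegree \<open>0\<close>, so that \<open>x^m Y_i\<close> and \<open>x^e\<close> are multihomogeneous, and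
    the part of \<open>\<tau>\<close>-largest multidegree of a relation between the \<open>f_e\<close> and \<open>x^m Y_i\<close> is a relation
    between the \<open>x^e\<close> and \<open>x^m Y_i\<close> (\<open>independent_family_of_leading_forms\<close>).  This is the torus action
    that degenerates \<open>I\<close> to \<open>in(I)\<close>, acting on the linear forms as well.

  The deformed elements lie in \<open>M_j\<close>, and a family in \<open>M_j\<close> that is independent over \<open>K[u]\<close> is at most
  as large as the set of leading monomials of \<open>M_j\<close> (\<open>card_independent_family_le_lead_set\<close>).
\<close>

section \<open>Products with a single term\<close>

lemma lookup_smult:
  fixes G :: "'m::monoid_add \<Rightarrow>\<^sub>0 'a::semiring_0"
  shows "Poly_Mapping.lookup (Poly_Mapping.single 0 a * G) m = a * Poly_Mapping.lookup G m"
proof -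
  have "Poly_Mapping.lookup (Poly_Mapping.map ((*) a) G) m = a * Poly_Mapping.lookup G m"
    by (simp add: Poly_Mapping.map.rep_eq when_def)
  then show ?thesis by (simp add: mult_map_scale_conv_mult)
qed

lemma lookup_monom_mult:
  fixes G :: "'m::cancel_comm_monoid_add \<Rightarrow>\<^sub>0 'a::semiring_0"
  shows "Poly_Mapping.lookup (Poly_Mapping.single k a * G) (k + m) = a * Poly_Mapping.lookup G m"
proof -
  have 1: "(\<Sum>q. Poly_Mapping.lookup G q when k + m = k + q) = Poly_Mapping.lookup G m"
    by simp
  have "Poly_Mapping.lookup (Poly_Mapping.single k a * G) (k + m) =
     (\<Sum>l. (a when k = l) * (\<Sum>q. Poly_Mapping.lookup G q when k + m = l + q))"
    by (simp add: lookup_mult lookup_single)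
  also have "\<dots> = (\<Sum>l. (a * (\<Sum>q. Poly_Mapping.lookup G q when k + m = l + q)) when k = l)"
    by (simp add: when_mult)
  also have "\<dots> = a * (\<Sum>q. Poly_Mapping.lookup G q when k + m = k + q)" by simp
  finally show ?thesis using 1 by simp
qed

lemma keys_monom_mult_subset:
  fixes G :: "'m::cancel_comm_monoid_add \<Rightarrow>\<^sub>0 'a::semiring_0"
  shows "Poly_Mapping.keys (Poly_Mapping.single k a * G) \<subseteq> (+) k ` Poly_Mapping.keys G"
  using keys_mult[of "Poly_Mapping.single k a" G] by (auto split: if_splits)

lemma lookup_monom_mult_outside:
  fixes G :: "'m::cancel_comm_monoid_add \<Rightarrow>\<^sub>0 'a::semiring_0"
  assumes "l \<notin> range ((+) k)"
  shows "Poly_Mapping.lookup (Poly_Mapping.single k a * G) l = 0"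
proof -
  have "l \<notin> Poly_Mapping.keys (Poly_Mapping.single k a * G)"
    using keys_monom_mult_subset[of k a G] assms by blast
  then show ?thesis by (simp add: in_keys_iff)
qed

lemma keys_monom_mult:
  fixes G :: "'m::cancel_comm_monoid_add \<Rightarrow>\<^sub>0 'a::semiring_1"
  shows "Poly_Mapping.keys (Poly_Mapping.single k 1 * G) = (+) k ` Poly_Mapping.keys G"
  using keys_monom_mult_subset[of k 1 G]
  by (auto simp: in_keys_iff lookup_monom_mult)

text \<open>
  Every polynomial is the sum of its terms.  This reduces statements on products to single terms.
\<close>

lemma poly_mapping_sum_singles:
  "F = (\<Sum>m\<in>Poly_Mapping.keys F. Poly_Mapping.single m (Poly_Mapping.lookup F m))"
  by (rule poly_mapping_eqI)
     (auto simp: lookup_sum lookup_single when_def in_keys_iff)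

global_interpretation pmod: Modules.module "\<lambda>a (G :: 'm::comm_monoid_add \<Rightarrow>\<^sub>0 'a::comm_ring_1). Poly_Mapping.single 0 a * G"
  by unfold_locales (simp_all add: algebra_simps single_add mult_single flip: mult.assoc)

global_interpretation pvs: vector_space "\<lambda>a (G :: 'm::comm_monoid_add \<Rightarrow>\<^sub>0 'a::field). Poly_Mapping.single 0 a * G"
  by unfold_locales (simp_all add: algebra_simps single_add mult_single flip: mult.assoc)

text \<open>
  Polynomials form a module over their coefficients.  Below, the coefficients are sometimes those of
  the field \<open>K\<close>, sometimes the polynomials over \<open>K\<close> in the parameters \<open>u_ik\<close>.
\<close>

abbreviation poly_span :: "('m::comm_monoid_add \<Rightarrow>\<^sub>0 'a::comm_ring_1) set \<Rightarrow> ('m \<Rightarrow>\<^sub>0 'a) set" where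
  "poly_span \<equiv> Modules.module.span (\<lambda>a G. Poly_Mapping.single 0 a * G)"

abbreviation poly_dependent :: "('m::comm_monoid_add \<Rightarrow>\<^sub>0 'a::comm_ring_1) set \<Rightarrow> bool" where
  "poly_dependent \<equiv> Modules.module.dependent (\<lambda>a G. Poly_Mapping.single 0 a * G)"

abbreviation poly_subspace :: "('m::comm_monoid_add \<Rightarrow>\<^sub>0 'a::comm_ring_1) set \<Rightarrow> bool" where
  "poly_subspace \<equiv> Modules.module.subspace (\<lambda>a G. Poly_Mapping.single 0 a * G)"

section \<open>Substitution into polynomials\<close>

definition monom_value :: "('v \<Rightarrow> 'b) \<Rightarrow> ('v \<Rightarrow>\<^sub>0 nat) \<Rightarrow> 'b::comm_semiring_1" where
  "monom_value g m = (\<Prod>x\<in>Poly_Mapping.keys m. g x ^ Poly_Mapping.lookup m x)"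

lemma monom_value_superset:
  assumes "finite X" "Poly_Mapping.keys m \<subseteq> X"
  shows "monom_value g m = (\<Prod>x\<in>X. g x ^ Poly_Mapping.lookup m x)"
  unfolding monom_value_def
  by (rule prod.mono_neutral_left) (use assms in \<open>auto simp: in_keys_iff\<close>)

lemma monom_value_0 [simp]: "monom_value g 0 = 1"
  by (simp add: monom_value_def)

lemma monom_value_add: "monom_value g (m + m') = monom_value g m * monom_value g m'"
proof -
  let ?X = "Poly_Mapping.keys m \<union> Poly_Mapping.keys m'"
  have "Poly_Mapping.keys (m + m') \<subseteq> ?X" by (rule Poly_Mapping.keys_add)
  then show ?thesis
    by (simp add: monom_value_superset[of ?X] lookup_add power_add prod.distrib)
qed

text \<open>
  The substitution homomorphism that maps coefficients by \<open>c\<close> and the variable \<open>x\<close> to \<open>g x\<close>.  The target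
  will be the field, for evaluation at a point; a univariate polynomial ring, for restriction to a
  line; and the polynomial ring itself, for evaluation of only some of the variables.
\<close>

definition subst :: "('k \<Rightarrow> 'b) \<Rightarrow> ('v \<Rightarrow> 'b) \<Rightarrow> ('v, 'k::zero) mpol \<Rightarrow> 'b::comm_semiring_1" where
  "subst c g F = (\<Sum>m\<in>Poly_Mapping.keys F. c (Poly_Mapping.lookup F m) * monom_value g m)"

locale coefficient_hom =
  fixes c :: "'k::comm_ring_1 \<Rightarrow> 'b::comm_ring_1"
  assumes zero: "c 0 = 0" and one: "c 1 = 1"
    and add: "c (a + b) = c a + c b" and mult: "c (a * b) = c a * c b"
begin

lemma subst_superset:
  assumes "finite X" "Poly_Mapping.keys F \<subseteq> X"
  shows "subst c g F = (\<Sum>m\<in>X. c (Poly_Mapping.lookup F m) * monom_value g m)"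
  unfolding subst_def
  by (rule sum.mono_neutral_left) (use assms in \<open>auto simp: in_keys_iff zero\<close>)

lemma subst_0 [simp]: "subst c g 0 = 0"
  by (simp add: subst_def)

lemma subst_single: "subst c g (Poly_Mapping.single m a) = c a * monom_value g m"
  by (simp add: subst_def zero)

lemma subst_1 [simp]: "subst c g 1 = 1"
  using subst_single[of g 0 1] by (simp add: one)

lemma subst_add: "subst c g (F + G) = subst c g F + subst c g G"
proof -
  let ?X = "Poly_Mapping.keys F \<union> Poly_Mapping.keys G"
  have "Poly_Mapping.keys (F + G) \<subseteq> ?X" by (rule Poly_Mapping.keys_add)
  then show ?thesis
    by (simp add: subst_superset[of ?X] lookup_add add distrib_right sum.distrib)
qed

lemma subst_sum: "subst c g (\<Sum>i\<in>S. F i) = (\<Sum>i\<in>S. subst c g (F i))"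
  by (induction S rule: infinite_finite_induct) (simp_all add: subst_add)

lemma subst_mult: "subst c g (F * G) = subst c g F * subst c g G"
proof -
  let ?s = "\<lambda>F m. Poly_Mapping.single m (Poly_Mapping.lookup F m)"
  have "subst c g (F * G) =
     subst c g ((\<Sum>m\<in>Poly_Mapping.keys F. ?s F m) * (\<Sum>m'\<in>Poly_Mapping.keys G. ?s G m'))"
    by (simp flip: poly_mapping_sum_singles)
  also have "\<dots> = (\<Sum>m\<in>Poly_Mapping.keys F. \<Sum>m'\<in>Poly_Mapping.keys G.
       subst c g (?s F m) * subst c g (?s G m'))"
    by (simp add: sum_product subst_sum mult_single subst_single mult monom_value_add mult_ac)
  also have "\<dots> = subst c g F * subst c g G"
    by (simp add: subst_def[of c g F] subst_def[of c g G] subst_single sum_product)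
  finally show ?thesis .
qed

lemma subst_prod: "subst c g (\<Prod>i\<in>S. F i) = (\<Prod>i\<in>S. subst c g (F i))"
  by (induction S rule: infinite_finite_induct) (simp_all add: subst_mult)

end

lemma poly_eval_eq_subst: "poly_eval a F = subst (\<lambda>c. c) a F"
  by (simp add: poly_eval_def subst_def monom_value_def)

global_interpretation eval: coefficient_hom "\<lambda>c::'k::field. c"
  by unfold_locales simp_all

global_interpretation along_line: coefficient_hom "\<lambda>c::'k::field. [:c:]"
  by unfold_locales simp_all

lemma subst_comp_hom:
  fixes h :: "'b::comm_ring_1 \<Rightarrow> 'd::comm_ring_1"
  assumes "\<And>x y. h (x + y) = h x + h y" "\<And>x y. h (x * y) = h x * h y" "h 1 = 1" "h 0 = 0"
  shows "h (subst c g F) = subst (\<lambda>x. h (c x)) (\<lambda>x. h (g x)) F"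
proof -
  have sum: "h (\<Sum>i\<in>S. f i) = (\<Sum>i\<in>S. h (f i))" for S and f :: "('e \<Rightarrow>\<^sub>0 nat) \<Rightarrow> 'b"
    by (induction S rule: infinite_finite_induct) (simp_all add: assms)
  have pow: "h (x ^ k) = h x ^ k" for x k by (induction k) (simp_all add: assms)
  have prod: "h (\<Prod>i\<in>S. f i) = (\<Prod>i\<in>S. h (f i))" for S and f :: "'e \<Rightarrow> 'b"
    by (induction S rule: infinite_finite_induct) (simp_all add: assms)
  show ?thesis by (simp add: subst_def monom_value_def sum assms(2) prod pow)
qed

section \<open>Nonvanishing of polynomials over an infinite field\<close>

text \<open>
  Induction on the number of variables.  The coefficient of a suitable power of the new variable
  \<open>x\<close> is a nonzero polynomial in the other variables; once these have values where it does not vanish,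
  a nonzero univariate polynomial in \<open>x\<close> remains, and it has only finitely many roots.
\<close>

lemma exists_nonvanishing_exponents:
  fixes c :: "('v \<Rightarrow> nat) \<Rightarrow> 'k::field"
  assumes "infinite (UNIV :: 'k set)" "finite V" "finite S"
    and "\<And>m m'. m \<in> S \<Longrightarrow> m' \<in> S \<Longrightarrow> (\<forall>v\<in>V. m v = m' v) \<Longrightarrow> m = m'"
    and "\<exists>m\<in>S. c m \<noteq> 0"
  shows "\<exists>b. (\<Sum>m\<in>S. c m * (\<Prod>v\<in>V. b v ^ m v)) \<noteq> 0"
  using assms(2-)
proof (induction V arbitrary: S rule: finite_induct)
  case empty
  then obtain m where "m \<in> S" "c m \<noteq> 0" by blast
  moreover have "S = {m}" using empty calculation by blast
  ultimately show ?case by simp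
next
  case (insert x V)
  obtain m0 where m0: "m0 \<in> S" "c m0 \<noteq> 0" using insert.prems by blast
  define T where "T d = {m\<in>S. m x = d}" for d
  have "\<exists>b. (\<Sum>m\<in>T (m0 x). c m * (\<Prod>v\<in>V. b v ^ m v)) \<noteq> 0"
  proof (rule insert.IH)
    show "finite (T (m0 x))" using insert.prems(1) by (simp add: T_def)
    show "\<exists>m\<in>T (m0 x). c m \<noteq> 0" using m0 by (auto simp: T_def)
    show "m = m'" if "m \<in> T (m0 x)" "m' \<in> T (m0 x)" "\<forall>v\<in>V. m v = m' v" for m m'
      using insert.prems(2)[of m m'] that by (auto simp: T_def)
  qed
  then obtain b where b: "(\<Sum>m\<in>T (m0 x). c m * (\<Prod>v\<in>V. b v ^ m v)) \<noteq> 0" by blast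
  define q where "q = (\<Sum>m\<in>S. Polynomial.monom (c m * (\<Prod>v\<in>V. b v ^ m v)) (m x))"
  have "Polynomial.coeff q (m0 x) = (\<Sum>m\<in>T (m0 x). c m * (\<Prod>v\<in>V. b v ^ m v))"
    using insert.prems(1) by (simp add: q_def T_def Polynomial.coeff_sum sum.inter_filter)
  then have "q \<noteq> 0" using b by auto
  then have "finite {z. poly q z = 0}" by (rule poly_roots_finite)
  then obtain z where z: "poly q z \<noteq> 0"
    using assms(1) ex_new_if_finite[of "{z. poly q z = 0}"] by auto
  have "(\<Sum>m\<in>S. c m * (\<Prod>v\<in>insert x V. (b(x := z)) v ^ m v)) = poly q z"
  proof -
    have "(\<Prod>v\<in>V. (b(x := z)) v ^ m v) = (\<Prod>v\<in>V. b v ^ m v)" for m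
      by (rule prod.cong) (use insert.hyps in auto)
    then show ?thesis
      using insert.hyps by (simp add: q_def poly_sum poly_monom mult_ac)
  qed
  then show ?case using z by metis
qed

lemma exists_nonvanishing_point:
  fixes F :: "('v, 'k::field) mpol"
  assumes "infinite (UNIV :: 'k set)" "F \<noteq> 0"
  shows "\<exists>b. poly_eval b F \<noteq> 0"
proof -
  define V where "V = (\<Union>m\<in>Poly_Mapping.keys F. Poly_Mapping.keys m)"
  define S where "S = Poly_Mapping.lookup ` Poly_Mapping.keys F"
  define c where "c m = Poly_Mapping.lookup F (Abs_poly_mapping m)" for m
  have finV: "finite V" by (simp add: V_def)
  have *: "\<exists>b. (\<Sum>m\<in>S. c m * (\<Prod>v\<in>V. b v ^ m v)) \<noteq> 0"
  proof (rule exists_nonvanishing_exponents[OF assms(1) finV])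
    show "finite S" by (simp add: S_def)
    obtain k where "k \<in> Poly_Mapping.keys F"
      using assms(2) keys_eq_empty[of F] by blast
    then show "\<exists>m\<in>S. c m \<noteq> 0"
      by (intro bexI[of _ "Poly_Mapping.lookup k"]) (simp_all add: S_def c_def in_keys_iff)
    show "m = m'" if mm: "m \<in> S" "m' \<in> S" "\<forall>v\<in>V. m v = m' v" for m m'
    proof -
      obtain k k' where k: "k \<in> Poly_Mapping.keys F" "k' \<in> Poly_Mapping.keys F"
        "m = Poly_Mapping.lookup k" "m' = Poly_Mapping.lookup k'"
        using mm by (auto simp: S_def)
      have "m v = m' v" if "v \<notin> V" for v
        using that k by (auto simp: V_def in_keys_iff)
      then show ?thesis using mm(3) by blast
    qed
  qed
  then obtain b where b: "(\<Sum>m\<in>S. c m * (\<Prod>v\<in>V. b v ^ m v)) \<noteq> 0" by blast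
  have "(\<Sum>m\<in>S. c m * (\<Prod>v\<in>V. b v ^ m v)) = poly_eval b F"
  proof -
    have inj: "inj_on Poly_Mapping.lookup (Poly_Mapping.keys F)"
      by (rule inj_onI) (simp add: poly_mapping_eqI)
    have "monom_value b m = (\<Prod>v\<in>V. b v ^ Poly_Mapping.lookup m v)"
      if "m \<in> Poly_Mapping.keys F" for m
      by (rule monom_value_superset[OF finV]) (use that in \<open>auto simp: V_def\<close>)
    then show ?thesis
      unfolding S_def poly_eval_eq_subst subst_def sum.reindex[OF inj] by (simp add: c_def)
  qed
  then show ?thesis using b by metis
qed

section \<open>Underdetermined linear systems\<close>

text \<open>
  A homogeneous linear system with more unknowns than equations has a nonzero solution over any
  integral domain, by elimination without division: with a pivot \<open>c g m \<noteq> 0\<close>, the equation \<open>m\<close> is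
  solved by multiplying all other unknowns by the pivot.
\<close>

lemma underdetermined_system_has_solution:
  fixes c :: "'g \<Rightarrow> 'm \<Rightarrow> 'a::idom"
  assumes "finite M" "finite \<Gamma>" "card M < card \<Gamma>"
  shows "\<exists>a. (\<exists>\<gamma>\<in>\<Gamma>. a \<gamma> \<noteq> 0) \<and> (\<forall>m\<in>M. (\<Sum>\<gamma>\<in>\<Gamma>. a \<gamma> * c \<gamma> m) = 0)"
  using assms
proof (induction M arbitrary: \<Gamma> c rule: finite_induct)
  case empty
  then have "\<Gamma> \<noteq> {}" by auto
  then show ?case by (intro exI[of _ "\<lambda>_. 1"]) auto
next
  case (insert m M)
  show ?case
  proof (cases "\<forall>\<gamma>\<in>\<Gamma>. c \<gamma> m = 0")
    case True
    have "card M < card \<Gamma>" using insert by simp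
    from insert.IH[OF insert.prems(1) this, of c] show ?thesis using True by auto
  next
    case False
    then obtain g where g: "g \<in> \<Gamma>" "c g m \<noteq> 0" by blast
    define \<Delta> where "\<Delta> = \<Gamma> - {g}"
    define c' where "c' \<gamma> m' = c g m * c \<gamma> m' - c \<gamma> m * c g m'" for \<gamma> m'
    have \<Delta>: "finite \<Delta>" "card M < card \<Delta>" "\<Gamma> = insert g \<Delta>" "g \<notin> \<Delta>"
      using insert g by (auto simp: \<Delta>_def)
    obtain a where a: "\<exists>\<gamma>\<in>\<Delta>. a \<gamma> \<noteq> 0" "\<forall>m'\<in>M. (\<Sum>\<gamma>\<in>\<Delta>. a \<gamma> * c' \<gamma> m') = 0"
      using insert.IH[OF \<Delta>(1,2), of c'] by blast
    define a' where "a' \<gamma> = (if \<gamma> = g then - (\<Sum>\<gamma>\<in>\<Delta>. a \<gamma> * c \<gamma> m) else c g m * a \<gamma>)" for \<gamma>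
    have eq: "(\<Sum>\<gamma>\<in>\<Gamma>. a' \<gamma> * c \<gamma> m') = (\<Sum>\<gamma>\<in>\<Delta>. a \<gamma> * c' \<gamma> m')" for m'
    proof -
      have "(\<Sum>\<gamma>\<in>\<Delta>. a' \<gamma> * c \<gamma> m') = (\<Sum>\<gamma>\<in>\<Delta>. c g m * a \<gamma> * c \<gamma> m')"
        by (rule sum.cong) (use \<Delta> in \<open>auto simp: a'_def\<close>)
      then show ?thesis
        using \<Delta> by (simp add: a'_def c'_def right_diff_distrib sum_subtractf sum_distrib_right
            sum_distrib_left mult_ac)
    qed
    have "(\<Sum>\<gamma>\<in>\<Gamma>. a' \<gamma> * c \<gamma> m') = 0" if "m' \<in> insert m M" for m'
    proof (cases "m' = m")
      case True
      then show ?thesis unfolding eq by (simp add: c'_def)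
    next
      case False
      then show ?thesis unfolding eq using a(2) that by auto
    qed
    moreover have "\<exists>\<gamma>\<in>\<Gamma>. a' \<gamma> \<noteq> 0"
      using a(1) g \<Delta> by (auto simp: a'_def)
    ultimately show ?thesis by blast
  qed
qed

section \<open>Dickson's lemma\<close>

text \<open>
  Dickson's lemma, by induction on the number of coordinates.  Let \<open>B\<close> be a finite set that works for
  the first \<open>n\<close> coordinates, and let \<open>N\<close> bound its last coordinates.  An element whose last coordinate
  is at least \<open>N\<close> lies above an element of \<open>B\<close>; each of the finitely many smaller values of the last
  coordinate is covered by the induction hypothesis.
\<close>

lemma dickson_functions:
  fixes L :: "(nat \<Rightarrow> nat) set"
  shows "\<exists>L0\<subseteq>L. finite L0 \<and> (\<forall>e\<in>L. \<exists>e0\<in>L0. \<forall>i<n. e0 i \<le> e i)"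
proof (induction n arbitrary: L)
  case 0
  show ?case
  proof (cases "L = {}")
    case False
    then obtain e where "e \<in> L" by blast
    then show ?thesis by (intro exI[of _ "{e}"]) auto
  qed auto
next
  case (Suc n)
  obtain B where B: "B \<subseteq> L" "finite B" "\<forall>e\<in>L. \<exists>e0\<in>B. \<forall>i<n. e0 i \<le> e i"
    using Suc.IH[of L] by blast
  obtain N where N: "\<And>e. e \<in> B \<Longrightarrow> e n \<le> N"
    using finite_nat_set_iff_bounded_le[of "(\<lambda>e. e n) ` B"] B(2) by auto
  have "\<forall>d. \<exists>D\<subseteq>{e\<in>L. e n = d}. finite D \<and> (\<forall>e\<in>{e\<in>L. e n = d}. \<exists>e0\<in>D. \<forall>i<n. e0 i \<le> e i)"
    using Suc.IH by blast
  from choice[OF this] obtain D where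
    D': "\<forall>d. D d \<subseteq> {e\<in>L. e n = d} \<and> finite (D d) \<and>
          (\<forall>e\<in>{e\<in>L. e n = d}. \<exists>e0\<in>D d. \<forall>i<n. e0 i \<le> e i)" ..
  have D: "D d \<subseteq> {e\<in>L. e n = d}" "finite (D d)"
    "e \<in> L \<Longrightarrow> e n = d \<Longrightarrow> \<exists>e0\<in>D d. \<forall>i<n. e0 i \<le> e i" for d e
    using D'[THEN spec, of d] by (simp_all add: Ball_def)
  let ?L0 = "B \<union> (\<Union>d<N. D d)"
  have "\<exists>e0\<in>?L0. \<forall>i<Suc n. e0 i \<le> e i" if e: "e \<in> L" for e
  proof (cases "e n < N")
    case True
    obtain e0 where e0: "e0 \<in> D (e n)" "\<forall>i<n. e0 i \<le> e i" using D(3)[OF e refl] by blast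
    moreover have "e0 n = e n" using e0 D(1) by blast
    ultimately show ?thesis using True by (intro bexI[of _ e0]) (auto simp: less_Suc_eq)
  next
    case False
    obtain e0 where e0: "e0 \<in> B" "\<forall>i<n. e0 i \<le> e i" using B(3) e by blast
    moreover have "e0 n \<le> e n" using N[OF e0(1)] False by simp
    ultimately show ?thesis by (intro bexI[of _ e0]) (auto simp: less_Suc_eq)
  qed
  moreover have "?L0 \<subseteq> L" using B(1) D(1) by blast
  moreover have "finite ?L0" using B(2) D(2) by simp
  ultimately show ?case by blast
qed

lemma dickson:
  fixes L :: "(nat \<Rightarrow>\<^sub>0 nat) set"
  assumes "L \<subseteq> monomials {..<n}"
  shows "\<exists>L0\<subseteq>L. finite L0 \<and> (\<forall>e\<in>L. \<exists>e0\<in>L0. \<exists>m\<in>monomials {..<n}. e = m + e0)"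
proof -
  obtain B where B: "B \<subseteq> Poly_Mapping.lookup ` L" "finite B"
    "\<forall>e\<in>Poly_Mapping.lookup ` L. \<exists>e0\<in>B. \<forall>i<n. e0 i \<le> e i"
    using dickson_functions[of "Poly_Mapping.lookup ` L" n] by blast
  obtain L0 where L0: "L0 \<subseteq> L" "finite L0" "B = Poly_Mapping.lookup ` L0"
    using finite_subset_image[OF B(2,1)] by blast
  have "\<exists>e0\<in>L0. \<exists>m\<in>monomials {..<n}. e = m + e0" if e: "e \<in> L" for e
  proof -
    obtain e0 where e0: "e0 \<in> L0" "\<forall>i<n. Poly_Mapping.lookup e0 i \<le> Poly_Mapping.lookup e i"
      using B(3) e L0(3) by blast
    have le: "Poly_Mapping.lookup e0 i \<le> Poly_Mapping.lookup e i" for i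
    proof (cases "i < n")
      case False
      then have "Poly_Mapping.lookup e0 i = 0"
        using e0(1) L0(1) assms by (auto simp: monomials_def simp flip: not_in_keys_iff_lookup_eq_zero)
      then show ?thesis by simp
    qed (use e0 in blast)
    have "e = (e - e0) + e0"
      by (rule poly_mapping_eqI) (simp add: lookup_add lookup_minus le)
    moreover have "e - e0 \<in> monomials {..<n}"
    proof -
      have "Poly_Mapping.keys (e - e0) \<subseteq> Poly_Mapping.keys e"
        by (auto simp: in_keys_iff lookup_minus)
      then show ?thesis using e assms by (auto simp: monomials_def)
    qed
    ultimately show ?thesis using e0(1) by blast
  qed
  then show ?thesis using L0 by blast
qed

section \<open>Monomials, degrees and the polynomial ring\<close>

lemma monomials_0 [simp]: "0 \<in> monomials V"
  by (simp add: monomials_def)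

lemma monomials_add [simp]: "m \<in> monomials V \<Longrightarrow> m' \<in> monomials V \<Longrightarrow> m + m' \<in> monomials V"
  using Poly_Mapping.keys_add[of m m'] by (auto simp: monomials_def)

lemma mdeg_superset:
  assumes "finite X" "Poly_Mapping.keys m \<subseteq> X"
  shows "mdeg m = (\<Sum>x\<in>X. Poly_Mapping.lookup m x)"
  unfolding mdeg_def
  by (rule sum.mono_neutral_left) (use assms in \<open>auto simp: in_keys_iff\<close>)

lemma mdeg_add [simp]: "mdeg (m + m') = mdeg m + mdeg m'"
proof -
  let ?X = "Poly_Mapping.keys m \<union> Poly_Mapping.keys m'"
  have "Poly_Mapping.keys (m + m') \<subseteq> ?X" by (rule Poly_Mapping.keys_add)
  then show ?thesis by (simp add: mdeg_superset[of ?X] lookup_add sum.distrib)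
qed

lemma mdeg_0 [simp]: "mdeg 0 = 0"
  by (simp add: mdeg_def)

lemma mdeg_single [simp]: "mdeg (Poly_Mapping.single x k) = k"
  by (simp add: mdeg_def)

definition degree_monomials :: "'v set \<Rightarrow> nat \<Rightarrow> ('v \<Rightarrow>\<^sub>0 nat) set" where
  "degree_monomials V j = {m \<in> monomials V. mdeg m = j}"

lemma finite_degree_monomials:
  assumes "finite V"
  shows "finite (degree_monomials V j)"
proof (rule inj_on_finite)
  let ?h = "\<lambda>m. restrict (Poly_Mapping.lookup m) V"
  show "inj_on ?h (degree_monomials V j)"
  proof (rule inj_onI, rule poly_mapping_eqI)
    fix m m' x
    assume m: "m \<in> degree_monomials V j" "m' \<in> degree_monomials V j" "?h m = ?h m'"
    show "Poly_Mapping.lookup m x = Poly_Mapping.lookup m' x"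
    proof (cases "x \<in> V")
      case True
      then show ?thesis using m(3) by (metis restrict_apply)
    next
      case False
      then have "x \<notin> Poly_Mapping.keys m" "x \<notin> Poly_Mapping.keys m'"
        using m by (auto simp: degree_monomials_def monomials_def)
      then show ?thesis by (simp add: in_keys_iff)
    qed
  qed
  have "Poly_Mapping.lookup m x \<le> j" if "m \<in> degree_monomials V j" "x \<in> V" for m x
  proof -
    have "mdeg m = (\<Sum>x\<in>V. Poly_Mapping.lookup m x)" "mdeg m = j"
      using that by (auto simp: degree_monomials_def monomials_def intro!: mdeg_superset assms)
    then show ?thesis using member_le_sum[of x V "Poly_Mapping.lookup m"] that assms by simp
  qed
  then show "?h ` degree_monomials V j \<subseteq> PiE V (\<lambda>_. {..j})"
    by auto
  show "finite (PiE V (\<lambda>_. {..j}))" using assms by (simp add: finite_PiE)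
qed

lemma graded_piece_iff:
  "f \<in> graded_piece V j \<longleftrightarrow> Poly_Mapping.keys f \<subseteq> degree_monomials V j"
  by (auto simp: graded_piece_def mpoly_ring_def degree_monomials_def)

lemma graded_piece_add: "f \<in> graded_piece V j \<Longrightarrow> g \<in> graded_piece V j \<Longrightarrow> f + g \<in> graded_piece V j"
  using Poly_Mapping.keys_add[of f g] by (auto simp: graded_piece_iff)

lemma graded_piece_0 [simp]: "0 \<in> graded_piece V j"
  by (simp add: graded_piece_iff)

lemma graded_piece_monom_mult:
  assumes "f \<in> graded_piece V j" "m \<in> monomials V"
  shows "Poly_Mapping.single m c * f \<in> graded_piece V (mdeg m + j)"
proof -
  have "(+) m ` Poly_Mapping.keys f \<subseteq> degree_monomials V (mdeg m + j)"
    using assms by (auto simp: graded_piece_iff degree_monomials_def)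
  then show ?thesis using keys_monom_mult_subset[of m c f] by (simp add: graded_piece_iff)
qed

lemma carrier_mpoly_ring [simp]: "f \<in> carrier (mpoly_ring V) \<longleftrightarrow> Poly_Mapping.keys f \<subseteq> monomials V"
  and mult_mpoly_ring [simp]: "monoid.mult (mpoly_ring V) = (*)"
  and one_mpoly_ring [simp]: "monoid.one (mpoly_ring V) = 1"
  and zero_mpoly_ring [simp]: "ring.zero (mpoly_ring V) = 0"
  and add_mpoly_ring [simp]: "ring.add (mpoly_ring V) = (+)"
  by (simp_all add: mpoly_ring_def)

lemma keys_mult_monomials:
  assumes "Poly_Mapping.keys f \<subseteq> monomials V" "Poly_Mapping.keys g \<subseteq> monomials V"
  shows "Poly_Mapping.keys (f * g) \<subseteq> monomials V"
  using keys_mult[of f g] assms by fastforce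

lemma keys_add_monomials:
  assumes "Poly_Mapping.keys f \<subseteq> monomials V" "Poly_Mapping.keys g \<subseteq> monomials V"
  shows "Poly_Mapping.keys (f + g) \<subseteq> monomials V"
  using Poly_Mapping.keys_add[of f g] assms by fastforce

lemma cring_mpoly_ring: "cring (mpoly_ring V :: ('v, 'k::field) mpol ring)"
proof (rule cringI)
  show "abelian_group (mpoly_ring V :: ('v, 'k) mpol ring)"
  proof (rule abelian_groupI)
    fix f :: "('v, 'k) mpol" assume "f \<in> carrier (mpoly_ring V)"
    then show "\<exists>g\<in>carrier (mpoly_ring V). g \<oplus>\<^bsub>mpoly_ring V\<^esub> f = \<zero>\<^bsub>mpoly_ring V\<^esub>"
      by (intro bexI[of _ "- f"]) (auto simp: in_keys_iff)
  qed (auto simp: keys_add_monomials add_ac)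
  show "Group.comm_monoid (mpoly_ring V :: ('v, 'k) mpol ring)"
    by (rule comm_monoidI) (auto simp: keys_mult_monomials mult_ac)
qed (auto simp: distrib_right)

context
  fixes V :: "'v set" and A :: "('v, 'k::field) mpol set"
  assumes ideal: "ideal A (mpoly_ring V)"
begin

lemma ideal_in_carrier: "f \<in> A \<Longrightarrow> Poly_Mapping.keys f \<subseteq> monomials V"
  using ideal.Icarr[OF ideal] by simp

lemma ideal_zero: "0 \<in> A"
  using additive_subgroup.zero_closed[OF ideal.axioms(1)[OF ideal]] by simp

lemma ideal_add: "f \<in> A \<Longrightarrow> g \<in> A \<Longrightarrow> f + g \<in> A"
  using additive_subgroup.a_closed[OF ideal.axioms(1)[OF ideal]] by simp

lemma ideal_mult: "f \<in> A \<Longrightarrow> Poly_Mapping.keys g \<subseteq> monomials V \<Longrightarrow> g * f \<in> A"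
  using ideal.I_l_closed[OF ideal, of f g] by simp

lemma ideal_smult: "f \<in> A \<Longrightarrow> Poly_Mapping.single 0 c * f \<in> A"
  by (rule ideal_mult) simp_all

lemma ideal_uminus: "f \<in> A \<Longrightarrow> - f \<in> A"
  using ideal_smult[of f "-1"] by (simp add: single_uminus)

lemma ideal_diff: "f \<in> A \<Longrightarrow> g \<in> A \<Longrightarrow> f - g \<in> A"
  using ideal_add[of f "- g"] ideal_uminus by simp

lemma coset_eq_iff: "A +>\<^bsub>mpoly_ring V\<^esub> f = A +>\<^bsub>mpoly_ring V\<^esub> g \<longleftrightarrow> f - g \<in> A"
proof -
  have mem: "h \<in> A +>\<^bsub>mpoly_ring V\<^esub> f \<longleftrightarrow> h - f \<in> A" for h f
    by (force simp: a_r_coset_def' algebra_simps)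
  show ?thesis
  proof
    assume "A +>\<^bsub>mpoly_ring V\<^esub> f = A +>\<^bsub>mpoly_ring V\<^esub> g"
    moreover have "f \<in> A +>\<^bsub>mpoly_ring V\<^esub> f" by (simp add: mem ideal_zero)
    ultimately show "f - g \<in> A" by (simp add: mem)
  next
    assume fg: "f - g \<in> A"
    have "h - f \<in> A \<longleftrightarrow> h - g \<in> A" for h
      using ideal_add[OF _ fg, of "h - f"] ideal_diff[OF _ fg, of "h - g"] by auto
    then show "A +>\<^bsub>mpoly_ring V\<^esub> f = A +>\<^bsub>mpoly_ring V\<^esub> g"
      by (auto simp: set_eq_iff mem)
  qed
qed

end

section \<open>Leading monomials\<close>

text \<open>
  The leading monomial of a polynomial with coefficients in an arbitrary ring, as it is needed for
  coefficients that are themselves polynomials.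
\<close>

definition lead_mon :: "'m rel \<Rightarrow> ('m \<Rightarrow>\<^sub>0 'a::zero) \<Rightarrow> 'm \<Rightarrow> bool" where
  "lead_mon \<tau> f m \<longleftrightarrow> m \<in> Poly_Mapping.keys f \<and> (\<forall>m'\<in>Poly_Mapping.keys f. (m', m) \<in> \<tau>)"

lemma is_leading_monomial_eq_lead_mon: "is_leading_monomial \<tau> f m = lead_mon \<tau> f m"
  by (simp add: is_leading_monomial_def lead_mon_def)

definition lead_set :: "'m rel \<Rightarrow> ('m \<Rightarrow>\<^sub>0 'a::zero) set \<Rightarrow> 'm set" where
  "lead_set \<tau> X = {m. \<exists>f\<in>X. lead_mon \<tau> f m}"

locale monomial_order =
  fixes V :: "'v set" and \<tau> :: "('v \<Rightarrow>\<^sub>0 nat) rel"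
  assumes finite_V: "finite V" and order: "term_order V \<tau>"
begin

lemma order_refl: "m \<in> monomials V \<Longrightarrow> (m, m) \<in> \<tau>"
  using order by (auto simp: term_order_def linear_order_on_def partial_order_on_def
      preorder_on_def refl_on_def)

lemma order_trans: "(a, b) \<in> \<tau> \<Longrightarrow> (b, c) \<in> \<tau> \<Longrightarrow> (a, c) \<in> \<tau>"
  using order by (auto simp: term_order_def linear_order_on_def partial_order_on_def
      preorder_on_def dest: transD)

lemma order_antisym: "(a, b) \<in> \<tau> \<Longrightarrow> (b, a) \<in> \<tau> \<Longrightarrow> a = b"
  using order by (auto simp: term_order_def linear_order_on_def partial_order_on_def
      dest: antisymD)

lemma order_total: "a \<in> monomials V \<Longrightarrow> b \<in> monomials V \<Longrightarrow> (a, b) \<in> \<tau> \<or> (b, a) \<in> \<tau>"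
  using order order_refl[of a]
  by (cases "a = b") (auto simp: term_order_def linear_order_on_def total_on_def)

lemma order_add: "(a, b) \<in> \<tau> \<Longrightarrow> c \<in> monomials V \<Longrightarrow> (a + c, b + c) \<in> \<tau>"
  using order by (simp add: term_order_def)

lemma order_add_cancel:
  assumes "a \<in> monomials V" "b \<in> monomials V" "c \<in> monomials V"
  shows "(a + c, b + c) \<in> \<tau> \<longleftrightarrow> (a, b) \<in> \<tau>"
  using order_total[OF assms(1,2)] order_add[OF _ assms(3)] order_antisym order_refl assms
  by (metis add_right_cancel)

lemma finite_has_greatest:
  assumes "finite X" "X \<noteq> {}" "X \<subseteq> monomials V"
  shows "\<exists>m\<in>X. \<forall>x\<in>X. (x, m) \<in> \<tau>"
  using assms
proof (induction X rule: finite_ne_induct)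
  case (singleton x)
  then show ?case by (simp add: order_refl)
next
  case (insert x X)
  then obtain m where m: "m \<in> X" "\<forall>x\<in>X. (x, m) \<in> \<tau>" by auto
  show ?case
  proof (cases "(x, m) \<in> \<tau>")
    case True
    then show ?thesis using m by blast
  next
    case False
    then have "(m, x) \<in> \<tau>" using order_total insert.prems m by blast
    then show ?thesis using m order_trans order_refl insert.prems by blast
  qed
qed

lemma exists_lead_mon:
  assumes "f \<noteq> 0" "Poly_Mapping.keys f \<subseteq> monomials V"
  shows "\<exists>m. lead_mon \<tau> f m"
  using finite_has_greatest[of "Poly_Mapping.keys f"] assms keys_eq_empty[of f]
  by (auto simp: lead_mon_def)

lemma lead_mon_monom_mult:
  fixes f :: "('v \<Rightarrow>\<^sub>0 nat) \<Rightarrow>\<^sub>0 'a::comm_ring_1"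
  assumes "lead_mon \<tau> f m" "k \<in> monomials V"
  shows "lead_mon \<tau> (Poly_Mapping.single k 1 * f) (k + m)"
  using assms order_add[OF _ assms(2)]
  by (auto simp: lead_mon_def keys_monom_mult add.commute[of k])

text \<open>
  In a linear relation, the largest of the leading monomials that occur cannot cancel.
\<close>

lemma independent_lead_mon:
  fixes g :: "('v \<Rightarrow>\<^sub>0 nat) \<Rightarrow> ('v, 'k::field) mpol"
  assumes "E \<subseteq> monomials V" "\<And>e. e \<in> E \<Longrightarrow> lead_mon \<tau> (g e) e"
  shows "inj_on g E" "\<not> poly_dependent (g ` E)"
proof -
  show inj: "inj_on g E"
  proof (rule inj_onI)
    fix e e' assume "e \<in> E" "e' \<in> E" "g e = g e'"
    with assms(2)[of e] assms(2)[of e'] show "e = e'"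
      by (auto simp: lead_mon_def intro: order_antisym)
  qed
  show "\<not> poly_dependent (g ` E)"
  proof
    assume "poly_dependent (g ` E)"
    then obtain T u where T: "finite T" "T \<subseteq> g ` E" "(\<Sum>v\<in>T. Poly_Mapping.single 0 (u v) * v) = 0"
      "\<exists>v\<in>T. u v \<noteq> 0"
      unfolding pmod.dependent_explicit by blast
    obtain D where D: "D \<subseteq> E" "T = g ` D" using subset_imageE[OF T(2)] by metis
    have injD: "inj_on g D" using inj D(1) by (rule inj_on_subset)
    have finD: "finite D" using T(1) D(2) injD by (simp add: finite_image_iff)
    define X where "X = {e\<in>D. u (g e) \<noteq> 0}"
    have "\<exists>m\<in>X. \<forall>x\<in>X. (x, m) \<in> \<tau>"
      by (rule finite_has_greatest) (use finD T(4) D assms(1) in \<open>auto simp: X_def\<close>)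
    then obtain m where m: "m \<in> X" "\<And>x. x \<in> X \<Longrightarrow> (x, m) \<in> \<tau>" by blast
    have "u (g e) * Poly_Mapping.lookup (g e) m = 0" if e: "e \<in> D" "e \<noteq> m" for e
    proof (cases "e \<in> X")
      case True
      have "m \<notin> Poly_Mapping.keys (g e)"
        using assms(2)[of e] e D(1) m(2)[OF True] order_antisym by (auto simp: lead_mon_def)
      then show ?thesis by (simp add: in_keys_iff)
    next
      case False
      then show ?thesis using e by (simp add: X_def)
    qed
    then have "(\<Sum>e\<in>D - {m}. u (g e) * Poly_Mapping.lookup (g e) m) = 0"
      by (intro sum.neutral) blast
    then have "(\<Sum>e\<in>D. u (g e) * Poly_Mapping.lookup (g e) m) = u (g m) * Poly_Mapping.lookup (g m) m"
      using finD m(1) by (subst sum.remove[of _ m]) (auto simp: X_def)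
    moreover have "(\<Sum>e\<in>D. u (g e) * Poly_Mapping.lookup (g e) m) = 0"
      using arg_cong[OF T(3), of "\<lambda>h. Poly_Mapping.lookup h m"]
      by (simp add: D(2) sum.reindex[OF injD] lookup_sum lookup_smult)
    moreover have "u (g m) * Poly_Mapping.lookup (g m) m \<noteq> 0"
      using m(1) assms(2)[of m] D(1) by (auto simp: X_def lead_mon_def in_keys_iff)
    ultimately show False by simp
  qed
qed

section \<open>Macaulay's theorem\<close>

text \<open>
  The dimension of \<open>[R/A]_j\<close> is computed by adding the monomials of degree \<open>j\<close> in increasing order.  A
  monomial is, modulo \<open>A\<close>, a combination of smaller ones if and only if it is the leading monomial of
  a form in \<open>A\<close>; only the others increase the dimension.
\<close>

lemma quotient_dimension_down_set:
  fixes A :: "('v, 'k::field) mpol set"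
  assumes ideal: "ideal A (mpoly_ring V)"
    and X: "X \<subseteq> degree_monomials V j"
    and down: "\<And>m m'. m \<in> X \<Longrightarrow> m' \<in> degree_monomials V j \<Longrightarrow> (m', m) \<in> \<tau> \<Longrightarrow> m' \<in> X"
  shows "ring.dimension (mpoly_ring V Quot A)
     (card (X - lead_set \<tau> (A \<inter> graded_piece V j)))
     (range (\<lambda>c. A +>\<^bsub>mpoly_ring V\<^esub> Poly_Mapping.single 0 c))
     ((\<lambda>f. A +>\<^bsub>mpoly_ring V\<^esub> f) ` {f. Poly_Mapping.keys f \<subseteq> X})"
  using X down
proof (induction "card X" arbitrary: X)
  let ?R = "mpoly_ring V :: ('v, 'k) mpol ring"
  let ?Q = "?R Quot A"
  let ?\<pi> = "\<lambda>f. A +>\<^bsub>?R\<^esub> f"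
  interpret hom: ring_hom_ring ?R ?Q ?\<pi>
    by (rule ideal.rcos_ring_hom_ring[OF ideal])
  {
    case 0
    have "finite X" using 0(2) finite_degree_monomials[OF finite_V] finite_subset by blast
    then have "X = {}" using 0(1) by simp
    moreover have "?\<pi> 0 = \<zero>\<^bsub>?Q\<^esub>" using hom.hom_zero by simp
    ultimately show ?case by auto
  next
    case (Suc c)
    let ?K = "range (\<lambda>c. A +>\<^bsub>?R\<^esub> Poly_Mapping.single 0 c)"
    let ?L = "lead_set \<tau> (A \<inter> graded_piece V j)"
    have fin: "finite X" using Suc.prems(1) finite_degree_monomials[OF finite_V] finite_subset by blast
    have "\<exists>m\<in>X. \<forall>x\<in>X. (x, m) \<in> \<tau>"
      by (rule finite_has_greatest)
         (use Suc.prems(1) Suc.hyps(2) fin in \<open>auto simp: degree_monomials_def\<close>)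
    then obtain m where m: "m \<in> X" "\<And>x. x \<in> X \<Longrightarrow> (x, m) \<in> \<tau>" by blast
    define Y where "Y = X - {m}"
    have XY: "X = insert m Y" "m \<notin> Y" using m by (auto simp: Y_def)
    have mV: "m \<in> monomials V" using m Suc.prems(1) by (auto simp: degree_monomials_def)
    have XV: "X \<subseteq> monomials V" using Suc.prems(1) by (auto simp: degree_monomials_def)
    have IH: "hom.S.dimension (card (Y - ?L)) ?K (?\<pi> ` {f. Poly_Mapping.keys f \<subseteq> Y})"
    proof (rule Suc.hyps(1))
      show "c = card Y" using Suc.hyps(2) fin m(1) by (simp add: Y_def)
      show "Y \<subseteq> degree_monomials V j" using Suc.prems(1) by (auto simp: Y_def)
      show "m'' \<in> Y" if "m' \<in> Y" "m'' \<in> degree_monomials V j" "(m'', m') \<in> \<tau>" for m' m''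
        using Suc.prems(2)[of m' m''] that m(2)[of m'] order_antisym by (auto simp: Y_def)
    qed
      have split: "Poly_Mapping.keys (f - Poly_Mapping.single m (Poly_Mapping.lookup f m)) \<subseteq> Y"
      if "Poly_Mapping.keys f \<subseteq> X" for f :: "('v, 'k) mpol"
      using that by (auto simp: Y_def in_keys_iff lookup_minus lookup_single when_def split: if_splits)
    show ?case
    proof (cases "m \<in> ?L")
      case True
      then obtain g where g: "g \<in> A" "g \<in> graded_piece V j" "lead_mon \<tau> g m"
        by (auto simp: lead_set_def)
      have gX: "Poly_Mapping.keys g \<subseteq> X"
        using g Suc.prems(2)[OF m(1)] by (auto simp: lead_mon_def graded_piece_iff)
      have gm: "Poly_Mapping.lookup g m \<noteq> 0" using g(3) by (simp add: lead_mon_def in_keys_iff)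
      have "?\<pi> ` {f. Poly_Mapping.keys f \<subseteq> X} = ?\<pi> ` {f. Poly_Mapping.keys f \<subseteq> Y}"
      proof (intro equalityI subsetI)
        fix u assume "u \<in> ?\<pi> ` {f. Poly_Mapping.keys f \<subseteq> X}"
        then obtain f where f: "Poly_Mapping.keys f \<subseteq> X" "u = ?\<pi> f" by blast
        define d where "d = Poly_Mapping.single 0 (Poly_Mapping.lookup f m / Poly_Mapping.lookup g m) * g"
        have "Poly_Mapping.keys (f - d) \<subseteq> Poly_Mapping.keys f \<union> Poly_Mapping.keys g"
          by (auto simp: d_def in_keys_iff lookup_minus lookup_smult)
        then have "Poly_Mapping.keys (f - d) \<subseteq> X" using f(1) gX by blast
        moreover have "Poly_Mapping.lookup (f - d) m = 0"
          using gm by (simp add: d_def lookup_minus lookup_smult)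
        ultimately have "Poly_Mapping.keys (f - d) \<subseteq> Y" by (auto simp: Y_def in_keys_iff)
        moreover have "u = ?\<pi> (f - d)"
          unfolding f(2) coset_eq_iff[OF ideal] by (simp add: d_def ideal_smult[OF ideal g(1)])
        ultimately show "u \<in> ?\<pi> ` {f. Poly_Mapping.keys f \<subseteq> Y}" by blast
      qed (auto simp: Y_def)
      moreover have "X - ?L = Y - ?L" using True XY by auto
      ultimately show ?thesis using IH by simp
    next
      case False
      have ext: "?\<pi> ` {f. Poly_Mapping.keys f \<subseteq> X} =
          hom.S.line_extension ?K (?\<pi> (Poly_Mapping.single m 1)) (?\<pi> ` {f. Poly_Mapping.keys f \<subseteq> Y})"
      proof -
        have eq: "?\<pi> (Poly_Mapping.single 0 c) \<otimes>\<^bsub>?Q\<^esub> ?\<pi> (Poly_Mapping.single m 1) \<oplus>\<^bsub>?Q\<^esub> ?\<pi> f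
            = ?\<pi> (Poly_Mapping.single m c + f)" if "Poly_Mapping.keys f \<subseteq> Y" for c f
        proof -
          have fV: "Poly_Mapping.keys f \<subseteq> monomials V" using that XV by (auto simp: Y_def)
          have "?\<pi> (Poly_Mapping.single 0 c) \<otimes>\<^bsub>?Q\<^esub> ?\<pi> (Poly_Mapping.single m 1)
              = ?\<pi> (Poly_Mapping.single m c)"
            using hom.hom_mult[of "Poly_Mapping.single 0 c" "Poly_Mapping.single m 1"] mV
            by (simp add: mult_single)
          then show ?thesis
            using hom.hom_add[of "Poly_Mapping.single m c" f] mV fV by simp
        qed
        show ?thesis
        proof (intro equalityI subsetI)
          fix u assume "u \<in> ?\<pi> ` {f. Poly_Mapping.keys f \<subseteq> X}"
          then obtain f where f: "Poly_Mapping.keys f \<subseteq> X" "u = ?\<pi> f" by blast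
          show "u \<in> hom.S.line_extension ?K (?\<pi> (Poly_Mapping.single m 1)) (?\<pi> ` {f. Poly_Mapping.keys f \<subseteq> Y})"
            unfolding hom.S.line_extension_mem_iff f(2)
            using eq[OF split[OF f(1)], of "Poly_Mapping.lookup f m"] split[OF f(1)] by force
        next
          fix u assume "u \<in> hom.S.line_extension ?K (?\<pi> (Poly_Mapping.single m 1)) (?\<pi> ` {f. Poly_Mapping.keys f \<subseteq> Y})"
          then obtain c f where f: "Poly_Mapping.keys f \<subseteq> Y" "u = ?\<pi> (Poly_Mapping.single m c + f)"
            unfolding hom.S.line_extension_mem_iff using eq by auto
          moreover have "Poly_Mapping.keys (Poly_Mapping.single m c + f) \<subseteq> X"
            using f(1) XY Poly_Mapping.keys_add[of "Poly_Mapping.single m c" f] by (auto split: if_splits)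
          ultimately show "u \<in> ?\<pi> ` {f. Poly_Mapping.keys f \<subseteq> X}" by blast
        qed
      qed
      have notin: "?\<pi> (Poly_Mapping.single m 1) \<notin> ?\<pi> ` {f. Poly_Mapping.keys f \<subseteq> Y}"
      proof
        assume "?\<pi> (Poly_Mapping.single m 1) \<in> ?\<pi> ` {f. Poly_Mapping.keys f \<subseteq> Y}"
        then obtain f where f: "Poly_Mapping.keys f \<subseteq> Y" "Poly_Mapping.single m 1 - f \<in> A"
          using coset_eq_iff[OF ideal] by auto
        have keys: "Poly_Mapping.keys (Poly_Mapping.single m 1 - f) \<subseteq> X"
          using f(1) XY by (auto simp: in_keys_iff lookup_minus lookup_single when_def split: if_splits)
        have "m \<notin> Poly_Mapping.keys f" using f(1) XY by blast
        then have "m \<in> Poly_Mapping.keys (Poly_Mapping.single m 1 - f)"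
          by (simp add: in_keys_iff lookup_minus)
        then have "lead_mon \<tau> (Poly_Mapping.single m 1 - f) m"
          using keys m(2) by (auto simp: lead_mon_def)
        moreover have "Poly_Mapping.single m 1 - f \<in> graded_piece V j"
          using keys Suc.prems(1) by (auto simp: graded_piece_iff)
        ultimately have "m \<in> ?L" using f(2) by (auto simp: lead_set_def)
        then show False using False by simp
      qed
      have "X - ?L = insert m (Y - ?L)" "finite (Y - ?L)" "m \<notin> Y - ?L"
        using False XY fin by auto
      then have "card (X - ?L) = Suc (card (Y - ?L))" by simp
      moreover have "?\<pi> (Poly_Mapping.single m 1) \<in> carrier ?Q"
        using hom.hom_closed[of "Poly_Mapping.single m 1"] mV by simp
      ultimately show ?thesis
        unfolding ext using hom.S.dimension.Suc_dim[OF _ notin IH] by simp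
    qed
  }
qed

lemma subfield_constants: "subfield (range (Poly_Mapping.single 0)) (mpoly_ring V :: ('v, 'k::field) mpol ring)"
proof -
  interpret cring "mpoly_ring V :: ('v, 'k) mpol ring" by (rule cring_mpoly_ring)
  let ?R = "mpoly_ring V :: ('v, 'k) mpol ring"
  let ?K = "range (Poly_Mapping.single 0) :: ('v, 'k) mpol set"
  have minus: "\<ominus>\<^bsub>?R\<^esub> Poly_Mapping.single 0 c = Poly_Mapping.single 0 (- c)" for c
    using minus_equality[of "Poly_Mapping.single 0 (- c)" "Poly_Mapping.single 0 c"]
    by (simp flip: single_add)
  have sub: "subring ?K ?R"
    by (rule subringI) (auto simp: minus mult_single simp flip: single_one single_add)
  show ?thesis
  proof (rule subfieldI)
    show "subcring ?K ?R"
      by (rule subcringI[OF sub]) (auto simp: mult.commute)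
    show "Units (?R\<lparr>carrier := ?K\<rparr>) = ?K - {\<zero>\<^bsub>?R\<^esub>}"
    proof (intro equalityI subsetI)
      fix x assume "x \<in> Units (?R\<lparr>carrier := ?K\<rparr>)"
      then show "x \<in> ?K - {\<zero>\<^bsub>?R\<^esub>}" by (auto simp: Units_def)
    next
      fix x assume "x \<in> ?K - {\<zero>\<^bsub>?R\<^esub>}"
      then obtain c where x: "x = Poly_Mapping.single 0 c" "x \<noteq> 0" by auto
      then have c: "x = Poly_Mapping.single 0 c" "c \<noteq> 0" by auto
      then show "x \<in> Units (?R\<lparr>carrier := ?K\<rparr>)"
        by (auto simp: Units_def mult_single intro!: exI[of _ "inverse c"])
    qed
  qed
qed

text \<open>
  Macaulay's theorem.  If \<open>A\<close> is the whole ring, the quotient is the zero ring and the image of \<open>K\<close> is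
  not a field, so that the uniqueness of the dimension has to be shown separately in that case.
\<close>

theorem hilbert_function_eq_card_standard_monomials:
  fixes A :: "('v, 'k::field) mpol set"
  assumes ideal: "ideal A (mpoly_ring V)"
  shows "hilbert_function V A j = card (degree_monomials V j - lead_set \<tau> (A \<inter> graded_piece V j))"
proof -
  let ?R = "mpoly_ring V :: ('v, 'k) mpol ring"
  let ?Q = "?R Quot A"
  let ?\<pi> = "\<lambda>f. A +>\<^bsub>?R\<^esub> f"
  let ?K = "range (\<lambda>c. ?\<pi> (Poly_Mapping.single 0 c))"
  let ?N = "card (degree_monomials V j - lead_set \<tau> (A \<inter> graded_piece V j))"
  interpret hom: ring_hom_ring ?R ?Q ?\<pi>
    by (rule ideal.rcos_ring_hom_ring[OF ideal])
  have dim: "hom.S.dimension ?N ?K (?\<pi> ` graded_piece V j)"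
  proof -
    have eq: "graded_piece V j = {f :: ('v, 'k) mpol. Poly_Mapping.keys f \<subseteq> degree_monomials V j}"
      by (auto simp: graded_piece_iff)
    show ?thesis
      using quotient_dimension_down_set[OF ideal subset_refl, of j] by (simp add: eq)
  qed
  have uniq: "k = ?N" if k: "hom.S.dimension k ?K (?\<pi> ` graded_piece V j)" for k
  proof (cases "\<one>\<^bsub>?Q\<^esub> = \<zero>\<^bsub>?Q\<^esub>")
    case False
    have "subfield (?\<pi> ` range (Poly_Mapping.single 0)) ?Q"
      by (rule hom.img_is_subfield[OF subfield_constants False])
    then have "subfield ?K ?Q" by (simp add: image_image)
    then show ?thesis using hom.S.dimension_is_inj[OF _ k dim] by simp
  next
    case True
    then have triv: "carrier ?Q = {\<zero>\<^bsub>?Q\<^esub>}" using hom.S.one_zeroD by simp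
    have zero: "n = 0 \<and> E = {\<zero>\<^bsub>?Q\<^esub>}" if "hom.S.dimension n ?K E" for n E
      using that
    proof (induction rule: hom.S.dimension.induct)
      case (Suc_dim v E n)
      then show ?case using triv by auto
    qed auto
    show ?thesis using zero[OF k] zero[OF dim] by simp
  qed
  show ?thesis
    unfolding hilbert_function_def hom.S.dim_def by (rule the_equality, rule dim, rule uniq)
qed

end

section \<open>Linear independence under deformation\<close>

text \<open>
  Linear independence of a family rather than of a set, since different members of a family over
  \<open>K[u]\<close> have to stay distinguished when the parameters are specialized.
\<close>

definition independent_family :: "'g set \<Rightarrow> ('g \<Rightarrow> 'm::comm_monoid_add \<Rightarrow>\<^sub>0 'a::comm_ring_1) \<Rightarrow> bool" where
  "independent_family \<Gamma> W \<longleftrightarrow>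
     (\<forall>a. (\<Sum>\<gamma>\<in>\<Gamma>. Poly_Mapping.single 0 (a \<gamma>) * W \<gamma>) = 0 \<longrightarrow> (\<forall>\<gamma>\<in>\<Gamma>. a \<gamma> = 0))"

definition specialize :: "('v \<Rightarrow> 'k) \<Rightarrow> ('m \<Rightarrow>\<^sub>0 ('v, 'k::field) mpol) \<Rightarrow> 'm \<Rightarrow>\<^sub>0 'k" where
  "specialize a G = Poly_Mapping.map (poly_eval a) G"

lemma lookup_specialize: "Poly_Mapping.lookup (specialize a G) m = poly_eval a (Poly_Mapping.lookup G m)"
  by (simp add: specialize_def Poly_Mapping.map.rep_eq when_def poly_eval_eq_subst)

lemma poly_eval_along_line:
  "poly (subst (\<lambda>c. [:c:]) (\<lambda>v. [:a v, b v - a v:]) F) t = poly_eval (\<lambda>v. a v + t * (b v - a v)) F"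
  unfolding poly_eval_eq_subst by (subst subst_comp_hom[where h = "\<lambda>q. poly q t"]) simp_all

text \<open>
  Let \<open>r\<close> be a relation over \<open>K[u]\<close> with \<open>r \<gamma>0 \<noteq> 0\<close>.  On the line from \<open>a\<close> to a point \<open>b\<close> where \<open>r \<gamma>0\<close>
  does not vanish, it becomes a nonzero relation with coefficients \<open>q \<gamma>\<close> in \<open>K[s]\<close>, where \<open>s = 0\<close> is the
  point \<open>a\<close>.  The coefficients of the lowest power of \<open>s\<close> that occurs in some \<open>q \<gamma>\<close> form a relation at \<open>a\<close>.
\<close>

lemma independent_family_of_specialization:
  fixes W :: "'g \<Rightarrow> 'm::comm_monoid_add \<Rightarrow>\<^sub>0 ('v, 'k::field) mpol"
  assumes inf: "infinite (UNIV :: 'k set)" and fin: "finite \<Gamma>"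
    and indep: "independent_family \<Gamma> (\<lambda>\<gamma>. specialize a (W \<gamma>))"
  shows "independent_family \<Gamma> W"
  unfolding independent_family_def
proof (intro allI impI, rule ccontr)
  fix r assume rel: "(\<Sum>\<gamma>\<in>\<Gamma>. Poly_Mapping.single 0 (r \<gamma>) * W \<gamma>) = 0" and "\<not> (\<forall>\<gamma>\<in>\<Gamma>. r \<gamma> = 0)"
  then obtain \<gamma>0 where \<gamma>0: "\<gamma>0 \<in> \<Gamma>" "r \<gamma>0 \<noteq> 0" by blast
  obtain b where b: "poly_eval b (r \<gamma>0) \<noteq> 0" using exists_nonvanishing_point[OF inf \<gamma>0(2)] by blast
  define \<psi> where "\<psi> = subst (\<lambda>c::'k. [:c:]) (\<lambda>v. [:a v, b v - a v:])"
  have \<psi>_poly: "poly (\<psi> F) t = poly_eval (\<lambda>v. a v + t * (b v - a v)) F" for F t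
    unfolding \<psi>_def by (rule poly_eval_along_line)
  define q where "q \<gamma> = \<psi> (r \<gamma>)" for \<gamma>
  have "q \<gamma>0 \<noteq> 0"
  proof
    assume "q \<gamma>0 = 0"
    then have "poly (q \<gamma>0) 1 = 0" by simp
    then show False using b by (simp add: q_def \<psi>_poly)
  qed
  then have ex: "\<exists>k. \<exists>\<gamma>\<in>\<Gamma>. Polynomial.coeff (q \<gamma>) k \<noteq> 0"
    using \<gamma>0(1) by (metis leading_coeff_0_iff)
  define k where "k = (LEAST k. \<exists>\<gamma>\<in>\<Gamma>. Polynomial.coeff (q \<gamma>) k \<noteq> 0)"
  have k: "\<exists>\<gamma>\<in>\<Gamma>. Polynomial.coeff (q \<gamma>) k \<noteq> 0" unfolding k_def by (rule LeastI_ex[OF ex])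
  have below: "Polynomial.coeff (q \<gamma>) i = 0" if "i < k" "\<gamma> \<in> \<Gamma>" for i \<gamma>
    using not_less_Least[OF that(1)[unfolded k_def]] that(2) by blast
  have "(\<Sum>\<gamma>\<in>\<Gamma>. Poly_Mapping.single 0 (Polynomial.coeff (q \<gamma>) k) * specialize a (W \<gamma>)) = 0"
  proof (rule poly_mapping_eqI)
    fix \<mu>
    have "(\<Sum>\<gamma>\<in>\<Gamma>. r \<gamma> * Poly_Mapping.lookup (W \<gamma>) \<mu>) = 0"
      using arg_cong[OF rel, of "\<lambda>h. Poly_Mapping.lookup h \<mu>"] by (simp add: lookup_sum lookup_smult)
    then have "\<psi> (\<Sum>\<gamma>\<in>\<Gamma>. r \<gamma> * Poly_Mapping.lookup (W \<gamma>) \<mu>) = 0"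
      by (simp add: \<psi>_def)
    then have "(\<Sum>\<gamma>\<in>\<Gamma>. q \<gamma> * \<psi> (Poly_Mapping.lookup (W \<gamma>) \<mu>)) = 0"
      by (simp add: \<psi>_def q_def along_line.subst_sum along_line.subst_mult)
    from arg_cong[OF this, of "\<lambda>h. Polynomial.coeff h k"]
    have "(\<Sum>\<gamma>\<in>\<Gamma>. Polynomial.coeff (q \<gamma> * \<psi> (Poly_Mapping.lookup (W \<gamma>) \<mu>)) k) = 0"
      by (simp add: Polynomial.coeff_sum)
    moreover have "Polynomial.coeff (q \<gamma> * \<psi> (Poly_Mapping.lookup (W \<gamma>) \<mu>)) k =
        Polynomial.coeff (q \<gamma>) k * poly_eval a (Poly_Mapping.lookup (W \<gamma>) \<mu>)" if "\<gamma> \<in> \<Gamma>" for \<gamma>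
    proof -
      let ?f = "\<psi> (Poly_Mapping.lookup (W \<gamma>) \<mu>)"
      have "Polynomial.coeff (q \<gamma> * ?f) k =
          (\<Sum>i\<le>k. Polynomial.coeff (q \<gamma>) i * Polynomial.coeff ?f (k - i))"
        by (rule coeff_mult)
      also have "\<dots> = (\<Sum>i\<in>{k}. Polynomial.coeff (q \<gamma>) i * Polynomial.coeff ?f (k - i))"
        by (rule sum.mono_neutral_right) (use below that in auto)
      also have "\<dots> = Polynomial.coeff (q \<gamma>) k * poly ?f 0" by (simp add: poly_0_coeff_0)
      finally show ?thesis by (simp add: \<psi>_poly)
    qed
    ultimately show "Poly_Mapping.lookup
        (\<Sum>\<gamma>\<in>\<Gamma>. Poly_Mapping.single 0 (Polynomial.coeff (q \<gamma>) k) * specialize a (W \<gamma>)) \<mu> =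
        Poly_Mapping.lookup 0 \<mu>"
      by (simp add: lookup_sum lookup_smult lookup_specialize)
  qed
  then have "\<forall>\<gamma>\<in>\<Gamma>. Polynomial.coeff (q \<gamma>) k = 0"
    using indep[unfolded independent_family_def, THEN spec, of "\<lambda>\<gamma>. Polynomial.coeff (q \<gamma>) k"]
    by simp
  then show False using k by blast
qed

lemma lookup_mult_eq_0:
  assumes "\<And>x y. x \<in> Poly_Mapping.keys f \<Longrightarrow> y \<in> Poly_Mapping.keys g \<Longrightarrow> x + y \<noteq> l"
  shows "Poly_Mapping.lookup (f * g) l = 0"
proof -
  have "l \<notin> Poly_Mapping.keys (f * g)" using keys_mult[of f g] assms by blast
  then show ?thesis by (simp add: in_keys_iff)
qed

context monomial_order
begin

text \<open>
  The term \<open>u^\<nu> x^\<mu>\<close> has multidegree \<open>\<mu> - w \<nu>\<close>.  Each \<open>G \<gamma>\<close> is multihomogeneous of multidegree \<open>\<delta> \<gamma>\<close>,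
  and \<open>H \<gamma>\<close> differs from it by terms of smaller multidegree.  So the part of largest multidegree of a
  relation between the \<open>H \<gamma>\<close> is a relation between the \<open>G \<gamma>\<close>.  The hypothesis \<open>lower\<close> expresses that
  a term is not at least as large as \<open>\<delta> \<gamma>\<close> without subtracting exponents.
\<close>

lemma independent_family_of_leading_forms:
  fixes G H :: "'g \<Rightarrow> ('v \<Rightarrow>\<^sub>0 nat) \<Rightarrow>\<^sub>0 (('u \<Rightarrow>\<^sub>0 nat) \<Rightarrow>\<^sub>0 'a::comm_ring_1)"
    and \<delta> :: "'g \<Rightarrow> 'v \<Rightarrow>\<^sub>0 nat" and w :: "('u \<Rightarrow>\<^sub>0 nat) \<Rightarrow> 'v \<Rightarrow>\<^sub>0 nat"
  assumes fin: "finite \<Gamma>"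
    and \<delta>: "\<And>\<gamma>. \<gamma> \<in> \<Gamma> \<Longrightarrow> \<delta> \<gamma> \<in> monomials V"
    and w_mon: "\<And>\<nu>. w \<nu> \<in> monomials V" and w_add: "\<And>\<nu> \<nu>'. w (\<nu> + \<nu>') = w \<nu> + w \<nu>'"
    and homogeneous: "\<And>\<gamma> \<mu> \<nu>. \<gamma> \<in> \<Gamma> \<Longrightarrow> \<nu> \<in> Poly_Mapping.keys (Poly_Mapping.lookup (G \<gamma>) \<mu>) \<Longrightarrow>
          \<mu> = \<delta> \<gamma> + w \<nu>"
    and lower: "\<And>\<gamma> \<mu> \<nu>. \<gamma> \<in> \<Gamma> \<Longrightarrow> \<nu> \<in> Poly_Mapping.keys (Poly_Mapping.lookup (H \<gamma> - G \<gamma>) \<mu>) \<Longrightarrow>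
          \<mu> \<in> monomials V \<and> (\<delta> \<gamma> + w \<nu>, \<mu>) \<notin> \<tau>"
    and indep: "independent_family \<Gamma> G"
  shows "independent_family \<Gamma> H"
  unfolding independent_family_def
proof (intro allI impI, rule ccontr)
  fix a assume rel: "(\<Sum>\<gamma>\<in>\<Gamma>. Poly_Mapping.single 0 (a \<gamma>) * H \<gamma>) = 0" and nz: "\<not> (\<forall>\<gamma>\<in>\<Gamma>. a \<gamma> = 0)"
  define T where "T = (SIGMA \<gamma>:\<Gamma>. Poly_Mapping.keys (a \<gamma>))"
  have finT: "finite T" using fin by (simp add: T_def)
  have neT: "T \<noteq> {}"
  proof -
    obtain \<gamma> where "\<gamma> \<in> \<Gamma>" "a \<gamma> \<noteq> 0" using nz by blast
    moreover obtain \<nu> where "\<nu> \<in> Poly_Mapping.keys (a \<gamma>)"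
      using calculation(2) keys_eq_empty[of "a \<gamma>"] by blast
    ultimately have "(\<gamma>, \<nu>) \<in> T" by (simp add: T_def)
    then show ?thesis by blast
  qed
  have w_sum: "(\<Sum>t\<in>S. w (snd t)) \<in> monomials V" for S :: "('g \<times> ('u \<Rightarrow>\<^sub>0 nat)) set"
    by (induction S rule: infinite_finite_induct) (simp_all add: w_mon)
  \<comment> \<open>The multidegree \<open>\<delta> \<gamma> - w \<nu>\<close> of the term \<open>\<nu>\<close> of \<open>a \<gamma>\<close> times \<open>G \<gamma>\<close> need not be a monomial.
    Adding the sum \<open>C\<close> of all \<open>w \<nu>\<close> that occur turns it into the monomial \<open>wt \<gamma> \<nu>\<close>.\<close>
  define C where "C = (\<Sum>t\<in>T. w (snd t))"
  define wt where "wt \<gamma> \<nu> = \<delta> \<gamma> + (\<Sum>t\<in>T - {(\<gamma>, \<nu>)}. w (snd t))" for \<gamma> \<nu>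
  have C: "C \<in> monomials V" unfolding C_def by (rule w_sum)
  have wt_mon: "wt \<gamma> \<nu> \<in> monomials V" if "\<gamma> \<in> \<Gamma>" for \<gamma> \<nu>
    unfolding wt_def using \<delta>[OF that] w_sum by simp
  have wt_eq: "wt \<gamma> \<nu> + w \<nu> = \<delta> \<gamma> + C" if "\<gamma> \<in> \<Gamma>" "\<nu> \<in> Poly_Mapping.keys (a \<gamma>)" for \<gamma> \<nu>
  proof -
    have "(\<gamma>, \<nu>) \<in> T" using that by (simp add: T_def)
    then have "C = w \<nu> + (\<Sum>t\<in>T - {(\<gamma>, \<nu>)}. w (snd t))"
      unfolding C_def using finT by (subst sum.remove) auto
    then show ?thesis by (simp add: wt_def add_ac)
  qed
  have "\<exists>M\<in>(\<lambda>t. wt (fst t) (snd t)) ` T. \<forall>x\<in>(\<lambda>t. wt (fst t) (snd t)) ` T. (x, M) \<in> \<tau>"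
    by (rule finite_has_greatest) (use finT neT wt_mon in \<open>auto simp: T_def\<close>)
  then obtain \<gamma>1 \<nu>1 where top: "(\<gamma>1, \<nu>1) \<in> T" "\<And>\<gamma> \<nu>. (\<gamma>, \<nu>) \<in> T \<Longrightarrow> (wt \<gamma> \<nu>, wt \<gamma>1 \<nu>1) \<in> \<tau>"
    by force
  define M where "M = wt \<gamma>1 \<nu>1"
  have M: "M \<in> monomials V" using top(1) wt_mon by (auto simp: M_def T_def)
  define a' where "a' \<gamma> = Poly_Mapping.mapp (\<lambda>\<nu> c. c when wt \<gamma> \<nu> = M) (a \<gamma>)" for \<gamma>
  have lookup_a': "Poly_Mapping.lookup (a' \<gamma>) \<nu> = (Poly_Mapping.lookup (a \<gamma>) \<nu> when wt \<gamma> \<nu> = M)" for \<gamma> \<nu>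
    by (auto simp: a'_def lookup_mapp when_def in_keys_iff)
  have "(\<Sum>\<gamma>\<in>\<Gamma>. Poly_Mapping.single 0 (a' \<gamma>) * G \<gamma>) = 0"
  proof (rule poly_mapping_eqI, rule poly_mapping_eqI)
    fix \<mu> :: "'v \<Rightarrow>\<^sub>0 nat" and \<nu> :: "'u \<Rightarrow>\<^sub>0 nat"
    have coeff: "Poly_Mapping.lookup (Poly_Mapping.lookup (\<Sum>\<gamma>\<in>\<Gamma>. Poly_Mapping.single 0 (b \<gamma>) * F \<gamma>) \<mu>) \<nu>
        = (\<Sum>\<gamma>\<in>\<Gamma>. Poly_Mapping.lookup (b \<gamma> * Poly_Mapping.lookup (F \<gamma>) \<mu>) \<nu>)"
      for b :: "'g \<Rightarrow> ('u \<Rightarrow>\<^sub>0 nat) \<Rightarrow>\<^sub>0 'a" and F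
      by (simp add: lookup_sum lookup_smult)
    have "(\<Sum>\<gamma>\<in>\<Gamma>. Poly_Mapping.lookup (a' \<gamma> * Poly_Mapping.lookup (G \<gamma>) \<mu>) \<nu>) = 0"
    \<comment> \<open>The case distinction asks whether \<open>u^\<nu> x^\<mu>\<close> has the largest multidegree.\<close>
    proof (cases "\<mu> + C = M + w \<nu>")
      case False
      have "Poly_Mapping.lookup (a' \<gamma> * Poly_Mapping.lookup (G \<gamma>) \<mu>) \<nu> = 0" if \<gamma>: "\<gamma> \<in> \<Gamma>" for \<gamma>
      proof (rule lookup_mult_eq_0)
        fix x y assume x: "x \<in> Poly_Mapping.keys (a' \<gamma>)"
          and y: "y \<in> Poly_Mapping.keys (Poly_Mapping.lookup (G \<gamma>) \<mu>)"
        have xa: "x \<in> Poly_Mapping.keys (a \<gamma>)" "wt \<gamma> x = M"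
          using x by (auto simp: in_keys_iff lookup_a')
        show "x + y \<noteq> \<nu>"
        proof
          assume "x + y = \<nu>"
          then have "M + w \<nu> = (wt \<gamma> x + w x) + w y" using xa(2) w_add[of x y] by (simp add: add_ac)
          also have "\<dots> = \<mu> + C" using wt_eq[OF \<gamma> xa(1)] homogeneous[OF \<gamma> y] by (simp add: add_ac)
          finally show False using False by simp
        qed
      qed
      then show ?thesis by simp
    next
      case True
      have "Poly_Mapping.lookup (a' \<gamma> * Poly_Mapping.lookup (G \<gamma>) \<mu>) \<nu> =
            Poly_Mapping.lookup (a \<gamma> * Poly_Mapping.lookup (H \<gamma>) \<mu>) \<nu>" if \<gamma>: "\<gamma> \<in> \<Gamma>" for \<gamma>
      proof -
        have 1: "Poly_Mapping.lookup ((a \<gamma> - a' \<gamma>) * Poly_Mapping.lookup (G \<gamma>) \<mu>) \<nu> = 0"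
        proof (rule lookup_mult_eq_0)
          fix x y assume x: "x \<in> Poly_Mapping.keys (a \<gamma> - a' \<gamma>)"
            and y: "y \<in> Poly_Mapping.keys (Poly_Mapping.lookup (G \<gamma>) \<mu>)"
          have xa: "x \<in> Poly_Mapping.keys (a \<gamma>)" "wt \<gamma> x \<noteq> M"
            using x by (auto simp: in_keys_iff lookup_a' lookup_minus)
          show "x + y \<noteq> \<nu>"
          proof
            assume "x + y = \<nu>"
            then have "M + w \<nu> = \<delta> \<gamma> + w y + C" using True homogeneous[OF \<gamma> y] by simp
            also have "\<dots> = wt \<gamma> x + w \<nu>"
              using wt_eq[OF \<gamma> xa(1)] \<open>x + y = \<nu>\<close> w_add[of x y] by (metis add.assoc add.commute)
            finally show False using xa(2) by simp
          qed
        qed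
        have 2: "Poly_Mapping.lookup (a \<gamma> * Poly_Mapping.lookup (H \<gamma> - G \<gamma>) \<mu>) \<nu> = 0"
        proof (rule lookup_mult_eq_0)
          fix x y assume x: "x \<in> Poly_Mapping.keys (a \<gamma>)"
            and y: "y \<in> Poly_Mapping.keys (Poly_Mapping.lookup (H \<gamma> - G \<gamma>) \<mu>)"
          show "x + y \<noteq> \<nu>"
          proof
            assume xy: "x + y = \<nu>"
            have "(wt \<gamma> x, M) \<in> \<tau>" using top(2)[of \<gamma> x] \<gamma> x by (simp add: T_def M_def)
            then have "(wt \<gamma> x + w \<nu>, M + w \<nu>) \<in> \<tau>" by (rule order_add) (rule w_mon)
            moreover have "wt \<gamma> x + w \<nu> = (\<delta> \<gamma> + w y) + C"
              using wt_eq[OF \<gamma> x] xy w_add[of x y] by (metis add.assoc add.commute)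
            ultimately have "((\<delta> \<gamma> + w y) + C, \<mu> + C) \<in> \<tau>" using True by simp
            then show False
              using lower[OF \<gamma> y] order_add_cancel[of "\<delta> \<gamma> + w y" \<mu> C] \<delta>[OF \<gamma>] w_mon C by simp
          qed
        qed
        have "a' \<gamma> * Poly_Mapping.lookup (G \<gamma>) \<mu> = a \<gamma> * Poly_Mapping.lookup (H \<gamma>) \<mu>
            - (a \<gamma> - a' \<gamma>) * Poly_Mapping.lookup (G \<gamma>) \<mu> - a \<gamma> * Poly_Mapping.lookup (H \<gamma> - G \<gamma>) \<mu>"
          by (simp add: lookup_minus algebra_simps)
        then show ?thesis using 1 2 by (simp add: lookup_minus)
      qed
      then have "(\<Sum>\<gamma>\<in>\<Gamma>. Poly_Mapping.lookup (a' \<gamma> * Poly_Mapping.lookup (G \<gamma>) \<mu>) \<nu>) =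
          (\<Sum>\<gamma>\<in>\<Gamma>. Poly_Mapping.lookup (a \<gamma> * Poly_Mapping.lookup (H \<gamma>) \<mu>) \<nu>)" by simp
      then show ?thesis using coeff[of a H] rel by simp
    qed
    then show "Poly_Mapping.lookup (Poly_Mapping.lookup (\<Sum>\<gamma>\<in>\<Gamma>. Poly_Mapping.single 0 (a' \<gamma>) * G \<gamma>) \<mu>) \<nu> =
        Poly_Mapping.lookup (Poly_Mapping.lookup 0 \<mu>) \<nu>"
      unfolding coeff by simp
  qed
  then have "a' \<gamma>1 = 0" using indep top(1) unfolding independent_family_def by (auto simp: T_def)
  then have "Poly_Mapping.lookup (a' \<gamma>1) \<nu>1 = 0" by simp
  then show False using top(1) by (auto simp: lookup_a' M_def T_def in_keys_iff)
qed

text \<open>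
  If there were more members than leading monomials, some nontrivial combination would have zero
  coefficients at all leading monomials of \<open>N\<close>.  Being an element of \<open>N\<close>, it would vanish.
\<close>

lemma card_independent_family_le_lead_set:
  fixes W :: "'g \<Rightarrow> ('v \<Rightarrow>\<^sub>0 nat) \<Rightarrow>\<^sub>0 'a::idom"
  assumes fin: "finite \<Gamma>" and W: "W ` \<Gamma> \<subseteq> N" and indep: "independent_family \<Gamma> W"
    and sub: "poly_subspace N"
    and keys: "\<And>f. f \<in> N \<Longrightarrow> Poly_Mapping.keys f \<subseteq> D" and D: "finite D" "D \<subseteq> monomials V"
  shows "card \<Gamma> \<le> card (lead_set \<tau> N)"
proof (rule ccontr)
  assume "\<not> ?thesis"
  then have less: "card (lead_set \<tau> N) < card \<Gamma>" by simp
  have "lead_set \<tau> N \<subseteq> D" using keys by (auto simp: lead_set_def lead_mon_def)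
  then have finL: "finite (lead_set \<tau> N)" using D(1) by (rule finite_subset)
  obtain a where a: "\<exists>\<gamma>\<in>\<Gamma>. a \<gamma> \<noteq> 0"
    "\<And>m. m \<in> lead_set \<tau> N \<Longrightarrow> (\<Sum>\<gamma>\<in>\<Gamma>. a \<gamma> * Poly_Mapping.lookup (W \<gamma>) m) = 0"
    using underdetermined_system_has_solution[OF finL fin less, of "\<lambda>\<gamma>. Poly_Mapping.lookup (W \<gamma>)"]
    by blast
  define F where "F = (\<Sum>\<gamma>\<in>\<Gamma>. Poly_Mapping.single 0 (a \<gamma>) * W \<gamma>)"
  have "F \<in> N" unfolding F_def
    by (intro pmod.subspace_sum[OF sub] pmod.subspace_scale[OF sub]) (use W in auto)
  have "F = 0"
  proof (rule ccontr)
    assume "F \<noteq> 0"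
    then obtain m where m: "lead_mon \<tau> F m" using exists_lead_mon keys[OF \<open>F \<in> N\<close>] D by blast
    then have "Poly_Mapping.lookup F m = 0"
      using a(2)[of m] \<open>F \<in> N\<close> by (auto simp: F_def lead_set_def lookup_sum lookup_smult)
    then show False using m by (simp add: lead_mon_def in_keys_iff)
  qed
  then show False using indep a(1) by (auto simp: independent_family_def F_def)
qed

end

section \<open>Homogeneous components\<close>

definition degree_component :: "nat \<Rightarrow> ('v, 'k::field) mpol \<Rightarrow> ('v, 'k) mpol" where
  "degree_component j f = Poly_Mapping.mapp (\<lambda>m c. c when mdeg m = j) f"

lemma lookup_degree_component:
  "Poly_Mapping.lookup (degree_component j f) m = (Poly_Mapping.lookup f m when mdeg m = j)"
  by (auto simp: degree_component_def lookup_mapp when_def in_keys_iff)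

lemma degree_component_0 [simp]: "degree_component j 0 = 0"
  by (rule poly_mapping_eqI) (simp add: lookup_degree_component)

lemma degree_component_add:
  "degree_component j (f + g) = degree_component j f + degree_component j g"
  by (rule poly_mapping_eqI) (simp add: lookup_degree_component lookup_add when_add_distrib)

lemma degree_component_graded_piece:
  assumes "f \<in> graded_piece V d"
  shows "degree_component j f = (if j = d then f else 0)"
proof (rule poly_mapping_eqI)
  fix m
  have "mdeg m = d" if "Poly_Mapping.lookup f m \<noteq> 0"
    using that assms by (auto simp: graded_piece_def in_keys_iff)
  then show "Poly_Mapping.lookup (degree_component j f) m = Poly_Mapping.lookup (if j = d then f else 0) m"
    by (cases "Poly_Mapping.lookup f m = 0") (auto simp: lookup_degree_component)
qed

lemma degree_component_monom_mult:
  "degree_component j (Poly_Mapping.single m c * f) =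
     (if mdeg m \<le> j then Poly_Mapping.single m c * degree_component (j - mdeg m) f else 0)"
proof (rule poly_mapping_eqI)
  fix l
  show "Poly_Mapping.lookup (degree_component j (Poly_Mapping.single m c * f)) l =
    Poly_Mapping.lookup (if mdeg m \<le> j then Poly_Mapping.single m c * degree_component (j - mdeg m) f else 0) l"
  proof (cases "l \<in> range ((+) m)")
    case True
    then obtain k where "l = m + k" by blast
    then show ?thesis
      by (auto simp: lookup_degree_component lookup_monom_mult when_def)
  next
    case False
    then show ?thesis by (simp add: lookup_degree_component lookup_monom_mult_outside)
  qed
qed

lemma degree_component_in_graded_piece:
  "Poly_Mapping.keys f \<subseteq> monomials V \<Longrightarrow> degree_component j f \<in> graded_piece V j"
  by (auto simp: graded_piece_def in_keys_iff lookup_degree_component)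

text \<open>
  This is how upper bounds for homogeneous ideals are obtained: to bound each degree of the ideal
  generated by some forms, exhibit a graded family that contains them and is closed under
  multiplication by terms.
\<close>

lemma ideal_of_graded_family:
  fixes Q :: "nat \<Rightarrow> ('v, 'k::field) mpol set"
  assumes zero: "\<And>j. 0 \<in> Q j" and add: "\<And>j f g. f \<in> Q j \<Longrightarrow> g \<in> Q j \<Longrightarrow> f + g \<in> Q j"
    and mult: "\<And>j f m c. f \<in> Q j \<Longrightarrow> m \<in> monomials V \<Longrightarrow> Poly_Mapping.single m c * f \<in> Q (mdeg m + j)"
  shows "ideal {f \<in> carrier (mpoly_ring V). \<forall>j. degree_component j f \<in> Q j} (mpoly_ring V)"
    (is "ideal ?I ?R")
proof -
  interpret cring ?R by (rule cring_mpoly_ring)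
  have monom: "Poly_Mapping.single m c * f \<in> ?I" if "f \<in> ?I" "m \<in> monomials V" for f m c
  proof -
    have "degree_component j (Poly_Mapping.single m c * f) \<in> Q j" for j
      using mult[of "degree_component (j - mdeg m) f" "j - mdeg m" m c] that zero
      by (auto simp: degree_component_monom_mult)
    then show ?thesis using that keys_mult_monomials[of "Poly_Mapping.single m c" V f] by auto
  qed
  have closed: "f + g \<in> ?I" if "f \<in> ?I" "g \<in> ?I" for f g
    using that add keys_add_monomials[of f V g] by (auto simp: degree_component_add)
  have zeroI: "0 \<in> ?I" using zero by simp
  have mult_closed: "g * f \<in> ?I" if f: "f \<in> ?I" and g: "g \<in> carrier ?R" for f g
  proof -
    have "(\<Sum>m\<in>S. Poly_Mapping.single m (Poly_Mapping.lookup g m) * f) \<in> ?I" if "S \<subseteq> monomials V" for S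
      using that
    proof (induction S rule: infinite_finite_induct)
      case (insert m S)
      then have "Poly_Mapping.single m (Poly_Mapping.lookup g m) * f +
          (\<Sum>m\<in>S. Poly_Mapping.single m (Poly_Mapping.lookup g m) * f) \<in> ?I"
        by (intro closed monom[OF f]) auto
      then show ?case using insert.hyps by simp
    qed (use zeroI in simp_all)
    from this[of "Poly_Mapping.keys g"] have
      "(\<Sum>m\<in>Poly_Mapping.keys g. Poly_Mapping.single m (Poly_Mapping.lookup g m)) * f \<in> ?I"
      using g by (simp add: sum_distrib_right)
    then show ?thesis by (simp flip: poly_mapping_sum_singles)
  qed
  have minus: "\<ominus>\<^bsub>?R\<^esub> f = Poly_Mapping.single 0 (- 1) * f" if "f \<in> ?I" for f
    using minus_equality[of "- f" f] that by (simp add: single_uminus in_keys_iff subset_iff)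
  show ?thesis
  proof (rule idealI)
    show "ring ?R" by unfold_locales
    show "subgroup ?I (add_monoid ?R)"
    proof (rule subgroup.intro)
      fix f assume f: "f \<in> ?I"
      have "\<ominus>\<^bsub>?R\<^esub> f \<in> ?I" unfolding minus[OF f] by (rule monom[OF f]) simp
      then show "inv\<^bsub>add_monoid ?R\<^esub> f \<in> ?I" by (simp add: a_inv_def)
    qed (use closed zeroI in auto)
  qed (use mult_closed in \<open>auto simp: mult.commute\<close>)
qed

lemma homogeneous_ideal_component:
  assumes I: "homogeneous_ideal V I" and f: "f \<in> I"
  shows "degree_component j f \<in> I"
proof -
  have ideal: "ideal I (mpoly_ring V)" using I by (simp add: homogeneous_ideal_def)
  obtain S where S: "S \<subseteq> (\<Union>j. graded_piece V j)" "I = Idl\<^bsub>mpoly_ring V\<^esub> S"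
    using I by (auto simp: homogeneous_ideal_def)
  interpret cring "mpoly_ring V" by (rule cring_mpoly_ring)
  have SR: "S \<subseteq> carrier (mpoly_ring V)" using S(1) by (auto simp: graded_piece_def)
  have SI: "S \<subseteq> I" unfolding S(2) by (rule genideal_self[OF SR])
  let ?C = "{f \<in> carrier (mpoly_ring V). \<forall>j. degree_component j f \<in> I}"
  have "I \<subseteq> ?C" unfolding S(2)
  proof (rule genideal_minimal)
    show "ideal {f \<in> carrier (mpoly_ring V). \<forall>j. degree_component j f \<in> Idl\<^bsub>mpoly_ring V\<^esub> S} (mpoly_ring V)"
      unfolding S(2)[symmetric]
    proof (rule ideal_of_graded_family)
      show "Poly_Mapping.single m c * f \<in> I" if "f \<in> I" "m \<in> monomials V" for f m c
        using ideal_mult[OF ideal that(1), of "Poly_Mapping.single m c"] that(2) by simp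
    qed (simp_all add: ideal_zero[OF ideal] ideal_add[OF ideal])
    show "S \<subseteq> {f \<in> carrier (mpoly_ring V). \<forall>j. degree_component j f \<in> Idl\<^bsub>mpoly_ring V\<^esub> S}"
    proof (intro subsetI CollectI conjI allI)
      fix s j assume s: "s \<in> S"
      then show "s \<in> carrier (mpoly_ring V)" using SR by blast
      obtain d where "s \<in> graded_piece V d" using s S(1) by blast
      then show "degree_component j s \<in> Idl\<^bsub>mpoly_ring V\<^esub> S"
        using SI s ideal_zero[OF ideal] unfolding S(2)[symmetric]
        by (auto simp: degree_component_graded_piece)
    qed
  qed
  then show ?thesis using f by blast
qed

section \<open>Generators of the initial ideal plus linear forms\<close>

context monomial_order
begin

text \<open>
  Vector space generators of the degree \<open>j\<close> part of \<open>in(I) + (y_0, \<dots>, y_(p-1))\<close>.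
\<close>

definition initial_generators ::
    "('v, 'k::field) mpol set \<Rightarrow> (nat \<Rightarrow> ('v, 'k) mpol) \<Rightarrow> nat \<Rightarrow> nat \<Rightarrow> ('v, 'k) mpol set" where
  "initial_generators I y p j =
     (\<lambda>e. Poly_Mapping.single e 1) ` lead_set \<tau> (I \<inter> graded_piece V j) \<union>
     {Poly_Mapping.single m 1 * y i | m i. m \<in> monomials V \<and> Suc (mdeg m) = j \<and> i < p}"

lemma lead_set_subset: "lead_set \<tau> (A \<inter> graded_piece V j) \<subseteq> degree_monomials V j"
  by (auto simp: lead_set_def lead_mon_def graded_piece_iff)

lemma finite_initial_generators: "finite (initial_generators I y p j)"
proof -
  have "finite (lead_set \<tau> (I \<inter> graded_piece V j))"
    using lead_set_subset finite_degree_monomials[OF finite_V] by (rule finite_subset)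
  moreover have "{Poly_Mapping.single m 1 * y i | m i. m \<in> monomials V \<and> Suc (mdeg m) = j \<and> i < p}
     \<subseteq> (\<lambda>(m, i). Poly_Mapping.single m 1 * y i) ` (degree_monomials V (j - 1) \<times> {..<p})"
    by (force simp: degree_monomials_def)
  then have "finite {Poly_Mapping.single m 1 * y i | m i. m \<in> monomials V \<and> Suc (mdeg m) = j \<and> i < p}"
    by (rule finite_subset) (simp add: finite_degree_monomials[OF finite_V])
  ultimately show ?thesis by (simp add: initial_generators_def)
qed

lemma initial_generators_shift:
  assumes I: "ideal I (mpoly_ring V)" and m: "m \<in> monomials V"
    and f: "f \<in> poly_span (initial_generators I y p j)"
  shows "Poly_Mapping.single m c * f \<in> poly_span (initial_generators I y p (mdeg m + j))"
  using f
proof (induction rule: pmod.span_induct_alt)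
  case base
  then show ?case by (simp add: pmod.span_zero)
next
  case (step a g f)
  have "Poly_Mapping.single m 1 * g \<in> initial_generators I y p (mdeg m + j)"
    using step(1) unfolding initial_generators_def
  proof (elim UnE)
    assume "g \<in> (\<lambda>e. Poly_Mapping.single e 1) ` lead_set \<tau> (I \<inter> graded_piece V j)"
    then obtain e h where e: "g = Poly_Mapping.single e 1" "h \<in> I" "h \<in> graded_piece V j" "lead_mon \<tau> h e"
      by (auto simp: lead_set_def)
    have "Poly_Mapping.single m 1 * h \<in> I \<inter> graded_piece V (mdeg m + j)"
      using ideal_mult[OF I e(2), of "Poly_Mapping.single m 1"] graded_piece_monom_mult[OF e(3) m] m by simp
    moreover have "lead_mon \<tau> (Poly_Mapping.single m 1 * h) (m + e)"
      by (rule lead_mon_monom_mult[OF e(4) m])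
    ultimately have "m + e \<in> lead_set \<tau> (I \<inter> graded_piece V (mdeg m + j))"
      unfolding lead_set_def by blast
    then show "Poly_Mapping.single m 1 * g \<in>
       (\<lambda>e. Poly_Mapping.single e 1) ` lead_set \<tau> (I \<inter> graded_piece V (mdeg m + j)) \<union>
       {Poly_Mapping.single m' 1 * y i | m' i. m' \<in> monomials V \<and> Suc (mdeg m') = mdeg m + j \<and> i < p}"
      by (simp add: e(1) mult_single)
  next
    assume "g \<in> {Poly_Mapping.single m 1 * y i | m i. m \<in> monomials V \<and> Suc (mdeg m) = j \<and> i < p}"
    then obtain m' i where g: "g = Poly_Mapping.single m' 1 * y i" "m' \<in> monomials V" "Suc (mdeg m') = j" "i < p"
      by blast
    have "Poly_Mapping.single m 1 * g = Poly_Mapping.single (m + m') 1 * y i"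
      by (simp add: g(1) mult_single flip: mult.assoc)
    moreover have "m + m' \<in> monomials V" "Suc (mdeg (m + m')) = mdeg m + j" using g m by auto
    ultimately show "Poly_Mapping.single m 1 * g \<in>
       (\<lambda>e. Poly_Mapping.single e 1) ` lead_set \<tau> (I \<inter> graded_piece V (mdeg m + j)) \<union>
       {Poly_Mapping.single m' 1 * y i | m' i. m' \<in> monomials V \<and> Suc (mdeg m') = mdeg m + j \<and> i < p}"
      using g(4) by blast
  qed
  then have "Poly_Mapping.single 0 (c * a) * (Poly_Mapping.single m 1 * g) \<in>
      poly_span (initial_generators I y p (mdeg m + j))"
    by (intro pmod.span_scale pmod.span_base)
  moreover have "Poly_Mapping.single 0 (c * a) * (Poly_Mapping.single m 1 * g) =
      Poly_Mapping.single m c * (Poly_Mapping.single 0 a * g)"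
    by (simp add: mult_single flip: mult.assoc)
  ultimately show ?case using step(2) by (simp add: distrib_left pmod.span_add)
qed

text \<open>
  Only homogeneous elements of \<open>I\<close> contribute to \<open>initial_generators\<close>.  This suffices because the
  homogeneous component of an element of \<open>I\<close> that contains its leading monomial is again in \<open>I\<close>.
\<close>

lemma initial_ideal_plus_forms_in_span:
  fixes I :: "('v, 'k::field) mpol set"
  assumes hom: "homogeneous_ideal V I" and y: "\<And>i. i < p \<Longrightarrow> y i \<in> graded_piece V 1"
    and f: "f \<in> initial_ideal V \<tau> I <+>\<^bsub>mpoly_ring V\<^esub> Idl\<^bsub>mpoly_ring V\<^esub> (y ` {..<p})" "f \<in> graded_piece V j"
  shows "f \<in> poly_span (initial_generators I y p j)"
proof -
  let ?R = "mpoly_ring V :: ('v, 'k) mpol ring"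
  interpret cring ?R by (rule cring_mpoly_ring)
  have I: "ideal I ?R" using hom by (simp add: homogeneous_ideal_def)
  let ?Q = "\<lambda>j. poly_span (initial_generators I y p j)"
  let ?C = "{f \<in> carrier ?R. \<forall>j. degree_component j f \<in> ?Q j}"
  have C: "ideal ?C ?R"
    by (rule ideal_of_graded_family)
       (simp_all add: pmod.span_zero pmod.span_add initial_generators_shift[OF I])
  have homogeneous_in_C: "g \<in> ?C" if "g \<in> ?Q d" "g \<in> graded_piece V d" for g d
  proof -
    have "degree_component j g \<in> ?Q j" for j
      using degree_component_graded_piece[OF that(2), of j] that(1) by (simp add: pmod.span_zero)
    then show ?thesis using that(2) by (simp add: graded_piece_def)
  qed
  have "initial_ideal V \<tau> I \<subseteq> ?C"
    unfolding initial_ideal_def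
  proof (rule genideal_minimal[OF C], intro subsetI)
    fix g :: "('v, 'k) mpol" assume "g \<in> {Poly_Mapping.single m 1 | f m. f \<in> I \<and> f \<noteq> 0 \<and> is_leading_monomial \<tau> f m}"
    then obtain h m where h: "g = Poly_Mapping.single m 1" "h \<in> I" "lead_mon \<tau> h m"
      by (auto simp: is_leading_monomial_eq_lead_mon)
    have m: "m \<in> monomials V" using h(3) ideal_in_carrier[OF I h(2)] by (auto simp: lead_mon_def)
    have "lead_mon \<tau> (degree_component (mdeg m) h) m"
      using h(3) by (auto simp: lead_mon_def in_keys_iff lookup_degree_component)
    moreover have "degree_component (mdeg m) h \<in> I \<inter> graded_piece V (mdeg m)"
      using homogeneous_ideal_component[OF hom h(2)] ideal_in_carrier[OF I h(2)]
        degree_component_in_graded_piece by blast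
    ultimately have "g \<in> initial_generators I y p (mdeg m)"
      unfolding initial_generators_def lead_set_def h(1) by blast
    then have "g \<in> ?Q (mdeg m)" by (rule pmod.span_base)
    moreover have "g \<in> graded_piece V (mdeg m)"
      using m by (simp add: h(1) graded_piece_iff degree_monomials_def)
    ultimately show "g \<in> ?C" by (rule homogeneous_in_C)
  qed
  moreover have "Idl\<^bsub>?R\<^esub> (y ` {..<p}) \<subseteq> ?C"
  proof (rule genideal_minimal[OF C], intro subsetI)
    fix g :: "('v, 'k) mpol" assume "g \<in> y ` {..<p}"
    then obtain i where i: "i < p" "g = y i" by blast
    have "Poly_Mapping.single 0 1 * y i \<in> initial_generators I y p 1"
      unfolding initial_generators_def
      by (intro UnI2 CollectI exI[of _ 0] exI[of _ i]) (simp add: i(1))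
    then have "g \<in> ?Q 1" by (simp add: i(2) pmod.span_base)
    moreover have "g \<in> graded_piece V 1" using y[OF i(1)] by (simp add: i(2))
    ultimately show "g \<in> ?C" by (rule homogeneous_in_C)
  qed
  moreover obtain g h where "g \<in> initial_ideal V \<tau> I" "h \<in> Idl\<^bsub>?R\<^esub> (y ` {..<p})" "f = g + h"
    using f(1) unfolding set_add_def' by auto
  ultimately have "f \<in> ?C" using ideal_add[OF C, of g h] by blast
  then have "degree_component j f \<in> ?Q j" by blast
  then show ?thesis using degree_component_graded_piece[OF f(2), of j] by simp
qed

end

section \<open>Generic linear forms\<close>

type_synonym 'k param = "(nat \<times> nat, 'k) mpol"

text \<open>
  A polynomial over \<open>K\<close> regarded as a polynomial over \<open>K[u]\<close>.
\<close>

definition const_ext :: "('m \<Rightarrow>\<^sub>0 'k::field) \<Rightarrow> 'm \<Rightarrow>\<^sub>0 ('v, 'k) mpol" where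
  "const_ext f = Poly_Mapping.map (Poly_Mapping.single 0) f"

lemma lookup_const_ext: "Poly_Mapping.lookup (const_ext f) m = Poly_Mapping.single 0 (Poly_Mapping.lookup f m)"
  by (simp add: const_ext_def Poly_Mapping.map.rep_eq when_def)

lemma single_eq_0_iff [simp]: "Poly_Mapping.single k v = 0 \<longleftrightarrow> v = 0"
  by (metis lookup_single_eq lookup_zero single_zero)

lemma keys_const_ext: "Poly_Mapping.keys (const_ext f) = Poly_Mapping.keys f"
  by (auto simp: in_keys_iff lookup_const_ext)

lemma specialize_const_ext [simp]: "specialize a (const_ext f) = f"
  by (rule poly_mapping_eqI)
     (simp add: lookup_specialize lookup_const_ext poly_eval_eq_subst eval.subst_single)

lemma specialize_0 [simp]: "specialize a 0 = 0"
  by (rule poly_mapping_eqI) (simp add: lookup_specialize poly_eval_eq_subst)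

lemma specialize_add: "specialize a (F + G) = specialize a F + specialize a G"
  by (rule poly_mapping_eqI) (simp add: lookup_specialize poly_eval_eq_subst lookup_add eval.subst_add)

lemma specialize_sum: "specialize a (\<Sum>i\<in>S. F i) = (\<Sum>i\<in>S. specialize a (F i))"
  by (induction S rule: infinite_finite_induct) (simp_all add: specialize_add)

lemma specialize_monom_mult:
  "specialize a (Poly_Mapping.single k c * G) =
     Poly_Mapping.single k (poly_eval a c) * specialize a (G :: 'm::cancel_comm_monoid_add \<Rightarrow>\<^sub>0 _)"
proof (rule poly_mapping_eqI)
  fix l
  show "Poly_Mapping.lookup (specialize a (Poly_Mapping.single k c * G)) l =
      Poly_Mapping.lookup (Poly_Mapping.single k (poly_eval a c) * specialize a G) l"
  proof (cases "l \<in> range ((+) k)")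
    case True
    then obtain m where "l = k + m" by blast
    then show ?thesis
      by (simp add: lookup_specialize lookup_monom_mult poly_eval_eq_subst eval.subst_mult)
  next
    case False
    then show ?thesis by (simp add: lookup_specialize lookup_monom_mult_outside poly_eval_eq_subst)
  qed
qed

lemma specialize_single: "specialize a (Poly_Mapping.single k c) = Poly_Mapping.single k (poly_eval a c)"
  by (rule poly_mapping_eqI)
     (simp add: lookup_specialize lookup_single when_def poly_eval_eq_subst)

definition generic_form :: "nat \<Rightarrow> nat \<Rightarrow> (nat \<Rightarrow>\<^sub>0 nat) \<Rightarrow>\<^sub>0 'k::field param" where
  "generic_form n i =
     (\<Sum>k<n. Poly_Mapping.single (Poly_Mapping.single k 1) (Poly_Mapping.single (Poly_Mapping.single (i, k) 1) 1))"

lemma degree_monomials_1: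
  assumes "m \<in> degree_monomials V 1"
  shows "\<exists>k\<in>V. m = Poly_Mapping.single k 1"
proof -
  have "(\<Sum>x\<in>Poly_Mapping.keys m. Poly_Mapping.lookup m x) = Suc 0"
    using assms by (simp add: degree_monomials_def mdeg_def)
  then obtain k where k: "k \<in> Poly_Mapping.keys m" "Poly_Mapping.lookup m k = Suc 0"
    "\<forall>x\<in>Poly_Mapping.keys m. k \<noteq> x \<longrightarrow> Poly_Mapping.lookup m x = 0"
    by (auto simp: sum_eq_Suc0_iff)
  have "m = Poly_Mapping.single k 1"
  proof (rule poly_mapping_eqI)
    fix x show "Poly_Mapping.lookup m x = Poly_Mapping.lookup (Poly_Mapping.single k 1) x"
      using k by (cases "x \<in> Poly_Mapping.keys m") (auto simp: lookup_single when_def in_keys_iff)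
  qed
  moreover have "k \<in> V" using k(1) assms by (auto simp: degree_monomials_def monomials_def)
  ultimately show ?thesis by blast
qed

lemma lookup_linear_form:
  fixes c :: "nat \<Rightarrow> 'a::comm_monoid_add"
  shows "Poly_Mapping.lookup (\<Sum>k<n. Poly_Mapping.single (Poly_Mapping.single k (1::nat)) (c k)) (Poly_Mapping.single k' 1)
     = (c k' when k' < n)"
proof -
  have "Poly_Mapping.single k (1::nat) = Poly_Mapping.single k' 1 \<longleftrightarrow> k = k'" for k
    by (metis lookup_single_eq lookup_single_not_eq zero_neq_one)
  then show ?thesis
    by (simp add: lookup_sum lookup_single when_def sum.delta)
qed

lemma linear_form_in_graded_piece:
  fixes c :: "nat \<Rightarrow> 'k::field"
  shows "(\<Sum>k<n. Poly_Mapping.single (Poly_Mapping.single k 1) (c k)) \<in> graded_piece {..<n} 1"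
proof -
  have "(\<Sum>k\<in>S. Poly_Mapping.single (Poly_Mapping.single k 1) (c k)) \<in> graded_piece {..<n} 1"
    if "S \<subseteq> {..<n}" for S
    using that
    by (induction S rule: infinite_finite_induct)
       (auto intro!: graded_piece_add simp: graded_piece_iff[of "Poly_Mapping.single _ _"] degree_monomials_def monomials_def)
  then show ?thesis by blast
qed

lemma linear_form_expansion:
  fixes f :: "(nat, 'k::field) mpol"
  assumes "f \<in> graded_piece {..<n} 1"
  shows "f = (\<Sum>k<n. Poly_Mapping.single (Poly_Mapping.single k 1) (Poly_Mapping.lookup f (Poly_Mapping.single k 1)))"
    (is "f = ?g")
proof (rule poly_mapping_eqI)
  fix m
  show "Poly_Mapping.lookup f m = Poly_Mapping.lookup ?g m"
  proof (cases "m \<in> degree_monomials {..<n} 1")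
    case True
    then obtain k where k: "k < n" "m = Poly_Mapping.single k 1"
      using degree_monomials_1[of m "{..<n}"] by auto
    show ?thesis unfolding k(2) by (subst lookup_linear_form) (simp add: k(1))
  next
    case False
    moreover have "?g \<in> graded_piece {..<n} 1" by (rule linear_form_in_graded_piece)
    ultimately have "m \<notin> Poly_Mapping.keys f" "m \<notin> Poly_Mapping.keys ?g"
      using assms unfolding graded_piece_iff by blast+
    then show ?thesis by (simp add: in_keys_iff)
  qed
qed

lemma specialize_generic_form:
  assumes "f \<in> graded_piece {..<n} 1"
    and "\<And>k. k < n \<Longrightarrow> a (i, k) = Poly_Mapping.lookup f (Poly_Mapping.single k 1)"
  shows "specialize a (generic_form n i) = f"
proof -
  have "specialize a (generic_form n i) = (\<Sum>k<n. Poly_Mapping.single (Poly_Mapping.single k 1) (a (i, k)))"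
    by (simp add: generic_form_def specialize_sum specialize_single poly_eval_eq_subst eval.subst_single monom_value_def)
  then show ?thesis using linear_form_expansion[OF assms(1)] assms(2) by simp
qed

lemma generic_form_homogeneous:
  assumes "\<nu> \<in> Poly_Mapping.keys (Poly_Mapping.lookup (generic_form n i :: _ \<Rightarrow>\<^sub>0 'k::field param) \<mu>)"
    (is "\<nu> \<in> Poly_Mapping.keys (Poly_Mapping.lookup ?Y \<mu>)")
  shows "\<exists>k<n. \<mu> = Poly_Mapping.single k 1 \<and> \<nu> = Poly_Mapping.single (i, k) 1"
proof -
  have "Poly_Mapping.lookup (Poly_Mapping.lookup ?Y \<mu>) \<nu> \<noteq> 0"
    using assms by (simp add: in_keys_iff)
  then obtain k where "k < n" "Poly_Mapping.lookup (Poly_Mapping.lookup (Poly_Mapping.single (Poly_Mapping.single k 1)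
      (Poly_Mapping.single (Poly_Mapping.single (i, k) 1) (1 :: 'k))) \<mu>) \<nu> \<noteq> 0"
    by (auto simp: generic_form_def lookup_sum elim!: sum.not_neutral_contains_not_neutral)
  then show ?thesis by (auto simp: lookup_single when_def split: if_splits)
qed

lemma keys_generic_form:
  "Poly_Mapping.keys (generic_form n i) \<subseteq> degree_monomials {..<n} 1" (is "Poly_Mapping.keys ?Y \<subseteq> _")
proof
  fix \<mu> assume "\<mu> \<in> Poly_Mapping.keys ?Y"
  then have "Poly_Mapping.keys (Poly_Mapping.lookup ?Y \<mu>) \<noteq> {}"
    unfolding keys_eq_empty by (simp add: in_keys_iff)
  then obtain \<nu> where "\<nu> \<in> Poly_Mapping.keys (Poly_Mapping.lookup ?Y \<mu>)" by blast
  from generic_form_homogeneous[OF this] show "\<mu> \<in> degree_monomials {..<n} 1"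
    by (auto simp: degree_monomials_def monomials_def)
qed

text \<open>
  The negative of the multidegree of a parameter monomial: \<open>u_ik\<close> has the multidegree inverse to that
  of \<open>x_k\<close>.  The parameters with \<open>k \<ge> n\<close>, which do not occur in the generic forms, count as constants,
  so that the value is a monomial in the \<open>n\<close> variables, where \<open>\<tau>\<close> is total.
\<close>

definition column_degree :: "nat \<Rightarrow> (nat \<times> nat \<Rightarrow>\<^sub>0 nat) \<Rightarrow> nat \<Rightarrow>\<^sub>0 nat" where
  "column_degree n \<nu> = (\<Sum>x\<in>Poly_Mapping.keys \<nu>.
     if snd x < n then Poly_Mapping.single (snd x) (Poly_Mapping.lookup \<nu> x) else 0)"

lemma column_degree_superset:
  assumes "finite X" "Poly_Mapping.keys \<nu> \<subseteq> X"
  shows "column_degree n \<nu> = (\<Sum>x\<in>X. if snd x < n then Poly_Mapping.single (snd x) (Poly_Mapping.lookup \<nu> x) else 0)"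
  unfolding column_degree_def
  by (rule sum.mono_neutral_left) (use assms in \<open>auto simp: in_keys_iff\<close>)

lemma column_degree_add: "column_degree n (\<nu> + \<nu>') = column_degree n \<nu> + column_degree n \<nu>'"
proof -
  let ?X = "Poly_Mapping.keys \<nu> \<union> Poly_Mapping.keys \<nu>'"
  have "Poly_Mapping.keys (\<nu> + \<nu>') \<subseteq> ?X" by (rule Poly_Mapping.keys_add)
  then show ?thesis
    by (simp add: column_degree_superset[of ?X] flip: sum.distrib)
       (intro sum.cong; simp add: lookup_add single_add)
qed

lemma column_degree_0 [simp]: "column_degree n 0 = 0"
  by (simp add: column_degree_def)

lemma column_degree_single [simp]: "k < n \<Longrightarrow> column_degree n (Poly_Mapping.single (i, k) c) = Poly_Mapping.single k c"
  by (simp add: column_degree_def)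

lemma column_degree_monomials: "column_degree n \<nu> \<in> monomials {..<n}"
proof -
  have "(\<Sum>x\<in>X. if snd x < n then Poly_Mapping.single (snd x) (Poly_Mapping.lookup \<nu> x) else 0) \<in> monomials {..<n}"
    for X :: "(nat \<times> nat) set"
  proof (induction X rule: infinite_finite_induct)
    case (insert x X)
    have "(if snd x < n then Poly_Mapping.single (snd x) (Poly_Mapping.lookup \<nu> x) else 0) \<in> monomials {..<n}"
      by (simp add: monomials_def)
    then show ?case using insert by simp
  qed simp_all
  then show ?thesis by (simp add: column_degree_def)
qed

text \<open>
  The degree \<open>j\<close> part of the ideal that \<open>I\<close> and the generic forms \<open>Y_0, \<dots>, Y_(p-1)\<close> generate over
  \<open>K[u]\<close>, described by generators as a module.
\<close>

definition generic_module :: "nat \<Rightarrow> (nat, 'k::field) mpol set \<Rightarrow> nat \<Rightarrow> nat \<Rightarrow> ((nat \<Rightarrow>\<^sub>0 nat) \<Rightarrow>\<^sub>0 'k param) set" where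
  "generic_module n I p j = poly_span (const_ext ` (I \<inter> graded_piece {..<n} j) \<union>
     {Poly_Mapping.single m 1 * generic_form n i | m i. m \<in> monomials {..<n} \<and> Suc (mdeg m) = j \<and> i < p})"

lemma generic_module_homogeneous:
  assumes "G \<in> generic_module n I p j"
  shows "Poly_Mapping.keys G \<subseteq> degree_monomials {..<n} j"
  using assms unfolding generic_module_def
proof (induction rule: pmod.span_induct_alt)
  case base
  then show ?case by simp
next
  case (step a F G)
  have "Poly_Mapping.keys F \<subseteq> degree_monomials {..<n} j"
    using step(1)
  proof
    assume "F \<in> const_ext ` (I \<inter> graded_piece {..<n} j)"
    then show ?thesis by (auto simp: keys_const_ext graded_piece_iff)
  next
    assume "F \<in> {Poly_Mapping.single m 1 * generic_form n i | m i. m \<in> monomials {..<n} \<and> Suc (mdeg m) = j \<and> i < p}"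
    then obtain m i where F: "F = Poly_Mapping.single m 1 * generic_form n i" "m \<in> monomials {..<n}" "Suc (mdeg m) = j"
      by blast
    have "(+) m ` Poly_Mapping.keys (generic_form n i) \<subseteq> degree_monomials {..<n} j"
      using F(2,3) keys_generic_form[of n i] by (auto simp: degree_monomials_def)
    then show ?thesis unfolding F(1) keys_monom_mult .
  qed
  then have "Poly_Mapping.keys (Poly_Mapping.single 0 a * F) \<subseteq> degree_monomials {..<n} j"
    by (auto simp: in_keys_iff lookup_smult)
  then show ?case using step(2) Poly_Mapping.keys_add[of "Poly_Mapping.single 0 a * F" G] by blast
qed

lemma specialize_generic_module:
  assumes A: "ideal A (mpoly_ring {..<n})" and I: "I \<subseteq> A"
    and y: "\<And>i. i < p \<Longrightarrow> specialize a (generic_form n i) \<in> A"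
    and G: "G \<in> generic_module n I p j"
  shows "specialize a G \<in> A"
  using G unfolding generic_module_def
proof (induction rule: pmod.span_induct_alt)
  case base
  then show ?case by (simp add: ideal_zero[OF A])
next
  case (step c F G)
  have "specialize a F \<in> A"
    using step(1)
  proof
    assume "F \<in> const_ext ` (I \<inter> graded_piece {..<n} j)"
    then show ?thesis using I by auto
  next
    assume "F \<in> {Poly_Mapping.single m 1 * generic_form n i | m i. m \<in> monomials {..<n} \<and> Suc (mdeg m) = j \<and> i < p}"
    then obtain m i where F: "F = Poly_Mapping.single m 1 * generic_form n i" "m \<in> monomials {..<n}" "i < p"
      by blast
    show ?thesis
      unfolding F(1) specialize_monom_mult by (rule ideal_mult[OF A y[OF F(3)]]) (use F(2) in auto)
  qed
  then show ?case
    using step(2) by (simp add: specialize_add specialize_monom_mult ideal_add[OF A] ideal_smult[OF A])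
qed

section \<open>Comparison with the generic situation\<close>

lemma independent_family_of_independent_set:
  assumes "finite \<Gamma>" "\<not> poly_dependent \<Gamma>"
  shows "independent_family \<Gamma> (\<lambda>\<gamma>. \<gamma>)"
  using assms unfolding independent_family_def
  by (auto simp: pmod.dependent_finite)

locale standard_monomial_order = monomial_order "{..<n}" \<tau> for n :: nat and \<tau> :: "(nat \<Rightarrow>\<^sub>0 nat) rel"
begin

text \<open>
  The deformation of a basis element \<open>\<gamma>\<close> of \<open>in(I) + J\<close>: it is the value at \<open>a\<close> of a multihomogeneous
  \<open>G\<close> of multidegree \<open>\<delta>\<close>, and \<open>G\<close> is the part of largest multidegree of an element \<open>H\<close> of the generic
  module.
\<close>

definition lifts_to :: "(nat, 'k::field) mpol set \<Rightarrow> nat \<Rightarrow> nat \<Rightarrow> (nat \<times> nat \<Rightarrow> 'k) \<Rightarrow> (nat, 'k) mpol \<Rightarrow>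
    ((nat \<Rightarrow>\<^sub>0 nat) \<Rightarrow>\<^sub>0 'k param) \<Rightarrow> ((nat \<Rightarrow>\<^sub>0 nat) \<Rightarrow>\<^sub>0 'k param) \<Rightarrow> (nat \<Rightarrow>\<^sub>0 nat) \<Rightarrow> bool" where
  "lifts_to I p j a \<gamma> G H \<delta> \<longleftrightarrow>
     specialize a G = \<gamma> \<and> H \<in> generic_module n I p j \<and> \<delta> \<in> monomials {..<n} \<and>
     (\<forall>\<mu> \<nu>. \<nu> \<in> Poly_Mapping.keys (Poly_Mapping.lookup G \<mu>) \<longrightarrow> \<mu> = \<delta> + column_degree n \<nu>) \<and>
     (\<forall>\<mu> \<nu>. \<nu> \<in> Poly_Mapping.keys (Poly_Mapping.lookup (H - G) \<mu>) \<longrightarrow>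
        \<mu> \<in> monomials {..<n} \<and> (\<delta> + column_degree n \<nu>, \<mu>) \<notin> \<tau>)"

text \<open>
  A leading monomial \<open>x^e\<close> of \<open>I\<close> is deformed to an element of \<open>I\<close> with leading term \<open>x^e\<close>, and \<open>x^m y_i\<close>
  to \<open>x^m Y_i\<close>, which is multihomogeneous already.
\<close>

lemma initial_generators_lift:
  fixes I :: "(nat, 'k::field) mpol set"
  assumes I: "ideal I (mpoly_ring {..<n})"
    and y: "\<And>i. i < p \<Longrightarrow> specialize a (generic_form n i) = y i"
    and \<gamma>: "\<gamma> \<in> initial_generators I y p j"
  shows "\<exists>G H \<delta>. lifts_to I p j a \<gamma> G H \<delta>"
  using \<gamma> unfolding initial_generators_def
proof
  assume "\<gamma> \<in> (\<lambda>e. Poly_Mapping.single e 1) ` lead_set \<tau> (I \<inter> graded_piece {..<n} j)"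
  then obtain e f where e: "\<gamma> = Poly_Mapping.single e 1" "f \<in> I" "f \<in> graded_piece {..<n} j" "lead_mon \<tau> f e"
    by (auto simp: lead_set_def)
  have lc: "Poly_Mapping.lookup f e \<noteq> 0" using e(4) by (simp add: lead_mon_def in_keys_iff)
  define h where "h = Poly_Mapping.single 0 (1 / Poly_Mapping.lookup f e) * f"
  have keys_h: "Poly_Mapping.keys h = Poly_Mapping.keys f"
    using lc by (auto simp: h_def in_keys_iff lookup_smult)
  have h1: "Poly_Mapping.lookup h e = 1" using lc by (simp add: h_def lookup_smult)
  have h: "h \<in> I \<inter> graded_piece {..<n} j"
    using e(2,3) ideal_smult[OF I e(2)] by (simp add: h_def[symmetric] keys_h graded_piece_iff) (simp add: h_def)
  have kV: "Poly_Mapping.keys f \<subseteq> monomials {..<n}" by (rule ideal_in_carrier[OF I e(2)])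
  have lower: "\<mu> \<in> monomials {..<n} \<and> (e + column_degree n \<nu>, \<mu>) \<notin> \<tau>"
    if "\<nu> \<in> Poly_Mapping.keys (Poly_Mapping.lookup (const_ext h - Poly_Mapping.single e (1 :: 'k param)) \<mu>)" for \<mu> \<nu>
  proof -
    have neq: "\<mu> \<noteq> e" using that h1 by (auto simp: lookup_minus lookup_const_ext)
    then have \<nu>: "\<nu> \<in> Poly_Mapping.keys (Poly_Mapping.single (0 :: nat \<times> nat \<Rightarrow>\<^sub>0 nat) (Poly_Mapping.lookup h \<mu>))"
      using that by (simp add: lookup_minus lookup_const_ext lookup_single_not_eq)
    then have "\<nu> = 0" "\<mu> \<in> Poly_Mapping.keys h" by (auto simp: in_keys_iff split: if_splits)
    then show ?thesis using e(4) neq order_antisym kV by (auto simp: keys_h lead_mon_def)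
  qed
  have "lifts_to I p j a \<gamma> (Poly_Mapping.single e 1) (const_ext h) e"
    unfolding lifts_to_def
  proof (intro conjI allI impI)
    show "specialize a (Poly_Mapping.single e 1) = \<gamma>"
      by (simp add: specialize_single e(1) poly_eval_eq_subst)
    show "const_ext h \<in> generic_module n I p j"
      unfolding generic_module_def using h by (intro pmod.span_base) blast
    show "e \<in> monomials {..<n}" using e(4) kV by (auto simp: lead_mon_def)
    show "\<mu> = e + column_degree n \<nu>"
      if "\<nu> \<in> Poly_Mapping.keys (Poly_Mapping.lookup (Poly_Mapping.single e 1) \<mu>)" for \<mu> \<nu>
      using that by (auto simp: lookup_single when_def split: if_splits)
  qed (use lower in blast)+
  then show ?thesis by blast
next
  assume "\<gamma> \<in> {Poly_Mapping.single m 1 * y i | m i. m \<in> monomials {..<n} \<and> Suc (mdeg m) = j \<and> i < p}"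
  then obtain m i where m: "\<gamma> = Poly_Mapping.single m 1 * y i" "m \<in> monomials {..<n}" "Suc (mdeg m) = j" "i < p"
    by blast
  let ?Y = "generic_form n i :: (nat \<Rightarrow>\<^sub>0 nat) \<Rightarrow>\<^sub>0 'k param"
  let ?G = "Poly_Mapping.single m 1 * ?Y"
  have "lifts_to I p j a \<gamma> ?G ?G m"
    unfolding lifts_to_def
  proof (intro conjI allI impI)
    show "specialize a ?G = \<gamma>"
      by (simp add: specialize_monom_mult y[OF m(4)] m(1) poly_eval_eq_subst)
    show "?G \<in> generic_module n I p j"
      unfolding generic_module_def using m by (intro pmod.span_base) blast
    show "\<mu> = m + column_degree n \<nu>" if "\<nu> \<in> Poly_Mapping.keys (Poly_Mapping.lookup ?G \<mu>)" for \<mu> \<nu>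
    proof -
      have "\<mu> \<in> range ((+) m)"
        using that lookup_monom_mult_outside[of \<mu> m 1 ?Y] by fastforce
      then obtain \<mu>' where \<mu>': "\<mu> = m + \<mu>'" by blast
      then have "\<nu> \<in> Poly_Mapping.keys (Poly_Mapping.lookup ?Y \<mu>')"
        using that by (simp add: lookup_monom_mult)
      from generic_form_homogeneous[OF this] show ?thesis using \<mu>' by auto
    qed
  qed (use m(2) in simp_all)
  then show ?thesis by blast
qed

text \<open>
  The set \<open>\<Gamma>\<close> is a basis of the degree \<open>j\<close> part of \<open>in(I) + J\<close> that consists of generators, and the
  deformed elements \<open>H \<gamma>\<close> form a family of the same size in the generic module that is still
  independent.
\<close>

lemma card_lead_set_initial_le_generic:
  fixes I :: "(nat, 'k::field) mpol set"
  assumes inf: "infinite (UNIV :: 'k set)"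
    and hom: "homogeneous_ideal {..<n} I" and y: "\<And>i. i < p \<Longrightarrow> y i \<in> graded_piece {..<n} 1"
  defines "B \<equiv> initial_ideal {..<n} \<tau> I <+>\<^bsub>mpoly_ring {..<n}\<^esub> Idl\<^bsub>mpoly_ring {..<n}\<^esub> (y ` {..<p})"
  shows "card (lead_set \<tau> (B \<inter> graded_piece {..<n} j)) \<le> card (lead_set \<tau> (generic_module n I p j))"
proof -
  have I: "ideal I (mpoly_ring {..<n})" using hom by (simp add: homogeneous_ideal_def)
  define a where "a = (\<lambda>(i, k). Poly_Mapping.lookup (y i) (Poly_Mapping.single k 1))"
  have spec: "specialize a (generic_form n i) = y i" if "i < p" for i
    by (rule specialize_generic_form[OF y[OF that]]) (simp add: a_def)
  let ?S = "initial_generators I y p j"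
  obtain \<Gamma> where \<Gamma>: "\<Gamma> \<subseteq> ?S" "\<not> poly_dependent \<Gamma>" "?S \<subseteq> poly_span \<Gamma>"
    using pvs.maximal_independent_subset[of ?S] by blast
  have fin: "finite \<Gamma>" using \<Gamma>(1) finite_initial_generators by (rule finite_subset)
  let ?E = "lead_set \<tau> (B \<inter> graded_piece {..<n} j)"
  have "\<forall>e\<in>?E. \<exists>g. g \<in> B \<inter> graded_piece {..<n} j \<and> lead_mon \<tau> g e" by (auto simp: lead_set_def)
  then obtain g where g: "\<And>e. e \<in> ?E \<Longrightarrow> g e \<in> B \<inter> graded_piece {..<n} j \<and> lead_mon \<tau> (g e) e"
    by metis
  have EV: "?E \<subseteq> monomials {..<n}" using lead_set_subset by (auto simp: degree_monomials_def)
  have indep: "inj_on g ?E" "\<not> poly_dependent (g ` ?E)"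
    using independent_lead_mon[OF EV, of g] g by blast+
  have "g ` ?E \<subseteq> poly_span ?S"
  proof (rule image_subsetI)
    fix e assume "e \<in> ?E"
    then have ge: "g e \<in> B" "g e \<in> graded_piece {..<n} j" using g by blast+
    show "g e \<in> poly_span ?S"
      by (rule initial_ideal_plus_forms_in_span[OF hom y _ ge(2)]) (use ge(1) in \<open>simp_all add: B_def\<close>)
  qed
  also have "poly_span ?S \<subseteq> poly_span \<Gamma>"
    by (rule pmod.span_minimal[OF \<Gamma>(3) pmod.subspace_span])
  finally have "card (g ` ?E) \<le> card \<Gamma>"
    using pvs.independent_span_bound[OF fin indep(2)] by blast
  then have "card ?E \<le> card \<Gamma>" by (simp add: card_image[OF indep(1)])
  also have "card \<Gamma> \<le> card (lead_set \<tau> (generic_module n I p j))"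
  proof -
    have "\<forall>\<gamma>\<in>\<Gamma>. \<exists>G H \<delta>. lifts_to I p j a \<gamma> G H \<delta>"
      using initial_generators_lift[OF I spec] \<Gamma>(1) by blast
    then obtain G H \<delta> where lift: "\<And>\<gamma>. \<gamma> \<in> \<Gamma> \<Longrightarrow> lifts_to I p j a \<gamma> (G \<gamma>) (H \<gamma>) (\<delta> \<gamma>)"
      by metis
    have "independent_family \<Gamma> (\<lambda>\<gamma>. specialize a (G \<gamma>))"
      using independent_family_of_independent_set[OF fin \<Gamma>(2)] lift
      by (simp add: independent_family_def lifts_to_def)
    then have indep_G: "independent_family \<Gamma> G"
      by (rule independent_family_of_specialization[OF inf fin])
    have "independent_family \<Gamma> H"
    proof (rule independent_family_of_leading_forms[OF fin _ _ _ _ _ indep_G])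
      show "\<delta> \<gamma> \<in> monomials {..<n}" if "\<gamma> \<in> \<Gamma>" for \<gamma>
        using lift[OF that] by (simp add: lifts_to_def)
      show "\<mu> = \<delta> \<gamma> + column_degree n \<nu>"
        if "\<gamma> \<in> \<Gamma>" "\<nu> \<in> Poly_Mapping.keys (Poly_Mapping.lookup (G \<gamma>) \<mu>)" for \<gamma> \<mu> \<nu>
        using lift[OF that(1)] that(2) by (simp add: lifts_to_def)
      show "\<mu> \<in> monomials {..<n} \<and> (\<delta> \<gamma> + column_degree n \<nu>, \<mu>) \<notin> \<tau>"
        if "\<gamma> \<in> \<Gamma>" "\<nu> \<in> Poly_Mapping.keys (Poly_Mapping.lookup (H \<gamma> - G \<gamma>) \<mu>)" for \<gamma> \<mu> \<nu>
        using lift[OF that(1)] that(2) by (simp add: lifts_to_def)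
    qed (simp_all add: column_degree_monomials column_degree_add)
    moreover have "H ` \<Gamma> \<subseteq> generic_module n I p j"
      using lift by (auto simp: lifts_to_def)
    moreover have "poly_subspace (generic_module n I p j)"
      unfolding generic_module_def by (rule pmod.subspace_span)
    ultimately show ?thesis
      using finite_degree_monomials[of "{..<n}" j]
      by (intro card_independent_family_le_lead_set[OF fin, where D = "degree_monomials {..<n} j"]
          generic_module_homogeneous) (auto simp: degree_monomials_def)
  qed
  finally show ?thesis .
qed

lemma lead_set_generic_module_subset:
  "lead_set \<tau> (generic_module n I p j) \<subseteq> degree_monomials {..<n} j"
proof
  fix e assume "e \<in> lead_set \<tau> (generic_module n I p j)"
  then obtain F where "F \<in> generic_module n I p j" "e \<in> Poly_Mapping.keys F"
    by (auto simp: lead_set_def lead_mon_def)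
  then show "e \<in> degree_monomials {..<n} j" using generic_module_homogeneous by blast
qed

lemma generic_initial_monomials_finite:
  fixes I :: "(nat, 'k::field) mpol set"
  shows "\<exists>L0. finite L0 \<and> L0 \<subseteq> (\<Union>j. lead_set \<tau> (generic_module n I p j)) \<and>
    (\<forall>e\<in>(\<Union>j. lead_set \<tau> (generic_module n I p j)). \<exists>e0\<in>L0. \<exists>m\<in>monomials {..<n}. e = m + e0)"
proof -
  have "(\<Union>j. lead_set \<tau> (generic_module n I p j)) \<subseteq> monomials {..<n}"
    using lead_set_generic_module_subset by (fastforce simp: degree_monomials_def)
  from dickson[OF this] show ?thesis by blast
qed

text \<open>
  The choice of \<open>\<alpha>\<close> cannot depend on the degree.  It is the product of the leading coefficients of
  finitely many elements whose leading monomials divide those of all others.  As the elements of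
  the generic modules may be multiplied by monomials after specialization, it is enough that these
  finitely many leading monomials persist.
\<close>

lemma generic_lead_set_specializes:
  fixes I :: "(nat, 'k::field) mpol set"
  shows "\<exists>\<alpha> :: 'k param. \<alpha> \<noteq> 0 \<and> (\<forall>a A j. poly_eval a \<alpha> \<noteq> 0 \<longrightarrow> ideal A (mpoly_ring {..<n}) \<longrightarrow> I \<subseteq> A \<longrightarrow>
     (\<forall>i<p. specialize a (generic_form n i) \<in> A) \<longrightarrow>
     lead_set \<tau> (generic_module n I p j) \<subseteq> lead_set \<tau> (A \<inter> graded_piece {..<n} j))"
proof -
  let ?M = "\<Union>j. lead_set \<tau> (generic_module n I p j)"
  from generic_initial_monomials_finite[of I p] obtain L0 where L0: "finite L0" "L0 \<subseteq> ?M"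
    "\<forall>e\<in>?M. \<exists>e0\<in>L0. \<exists>m\<in>monomials {..<n}. e = m + e0"
    by (elim exE conjE) (rule that)
  have "\<forall>e\<in>L0. \<exists>F. (\<exists>j. F \<in> generic_module n I p j) \<and> lead_mon \<tau> F e"
  proof
    fix e assume "e \<in> L0"
    then obtain j where "e \<in> lead_set \<tau> (generic_module n I p j)" using L0(2) by blast
    then obtain F where "F \<in> generic_module n I p j" "lead_mon \<tau> F e"
      by (auto simp: lead_set_def)
    then show "\<exists>F. (\<exists>j. F \<in> generic_module n I p j) \<and> lead_mon \<tau> F e" by blast
  qed
  then obtain F where F: "\<And>e. e \<in> L0 \<Longrightarrow> (\<exists>j. F e \<in> generic_module n I p j) \<and> lead_mon \<tau> (F e) e"
    by metis
  define \<alpha> where "\<alpha> = (\<Prod>e\<in>L0. Poly_Mapping.lookup (F e) e)"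
  have "\<alpha> \<noteq> 0" using F L0(1) by (auto simp: \<alpha>_def lead_mon_def in_keys_iff)
  moreover have "e \<in> lead_set \<tau> (A \<inter> graded_piece {..<n} j)"
    if \<alpha>: "poly_eval a \<alpha> \<noteq> 0" and A: "ideal A (mpoly_ring {..<n})" and IA: "I \<subseteq> A"
      and y: "\<And>i. i < p \<Longrightarrow> specialize a (generic_form n i) \<in> A"
      and e: "e \<in> lead_set \<tau> (generic_module n I p j)" for a A j e
  proof -
    obtain e0 m where e0: "e0 \<in> L0" "m \<in> monomials {..<n}" "e = m + e0"
    proof -
      have "e \<in> ?M" using e by auto
      then show ?thesis using L0(3) that by blast
    qed
    obtain j0 where j0: "F e0 \<in> generic_module n I p j0" using F[OF e0(1)] by blast
    have lead: "lead_mon \<tau> (F e0) e0" using F[OF e0(1)] by blast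
    let ?f = "specialize a (F e0)"
    have "poly_eval a (Poly_Mapping.lookup (F e0) e0) \<noteq> 0"
      using \<alpha> L0(1) e0(1) by (auto simp: \<alpha>_def poly_eval_eq_subst eval.subst_prod)
    moreover have keys: "Poly_Mapping.keys ?f \<subseteq> Poly_Mapping.keys (F e0)"
      by (auto simp: in_keys_iff lookup_specialize poly_eval_eq_subst)
    ultimately have f: "lead_mon \<tau> ?f e0"
      using lead by (auto simp: lead_mon_def in_keys_iff lookup_specialize)
    have "?f \<in> A" by (rule specialize_generic_module[OF A IA y j0])
    then have mA: "Poly_Mapping.single m 1 * ?f \<in> A" using e0(2) by (intro ideal_mult[OF A]) auto
    have lead_e: "lead_mon \<tau> (Poly_Mapping.single m 1 * ?f) e"
      unfolding e0(3) by (rule lead_mon_monom_mult[OF f e0(2)])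
    have "?f \<in> graded_piece {..<n} j0"
      using keys generic_module_homogeneous[OF j0] by (auto simp: graded_piece_iff)
    then have "Poly_Mapping.single m 1 * ?f \<in> graded_piece {..<n} (mdeg m + j0)"
      using e0(2) by (rule graded_piece_monom_mult)
    moreover have "mdeg m + j0 = j"
    proof -
      have "e \<in> degree_monomials {..<n} j"
        using e lead_set_generic_module_subset by blast
      moreover have "e0 \<in> degree_monomials {..<n} j0"
        using lead generic_module_homogeneous[OF j0] by (auto simp: lead_mon_def)
      ultimately show ?thesis by (simp add: e0(3) degree_monomials_def)
    qed
    ultimately show ?thesis using mA lead_e by (auto simp: lead_set_def)
  qed
  ultimately show ?thesis by (intro exI[of _ \<alpha>]) blast
qed

end

text \<open>
  Scalars of the generic module may involve parameters \<open>u_ik\<close> with \<open>i \<ge> p\<close> or \<open>k \<ge> n\<close>, which are not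
  coordinates of the space of tuples of linear forms.  They are given fixed values.
\<close>

lemma exists_partial_evaluation:
  fixes \<alpha> :: "('v, 'k::field) mpol"
  shows "\<exists>\<beta>\<in>carrier (mpoly_ring P). \<forall>c. poly_eval c \<beta> = poly_eval (\<lambda>x. if x \<in> P then c x else b x) \<alpha>"
proof -
  define g :: "'v \<Rightarrow> ('v, 'k) mpol" where
    "g x = (if x \<in> P then Poly_Mapping.single (Poly_Mapping.single x 1) 1 else Poly_Mapping.single 0 (b x))" for x
  define \<beta> where "\<beta> = subst (Poly_Mapping.single 0) g \<alpha>"
  have g: "Poly_Mapping.keys (g x) \<subseteq> monomials P" for x
    by (simp add: g_def monomials_def)
  have pow: "Poly_Mapping.keys (g x ^ k) \<subseteq> monomials P" for x k
    by (induction k) (simp_all add: keys_mult_monomials g)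
  have prod: "Poly_Mapping.keys (\<Prod>x\<in>X. g x ^ k x) \<subseteq> monomials P" for X k
    by (induction X rule: infinite_finite_induct) (simp_all add: keys_mult_monomials pow)
  have "Poly_Mapping.keys (\<Sum>m\<in>S. Poly_Mapping.single 0 (Poly_Mapping.lookup \<alpha> m) * monom_value g m) \<subseteq> monomials P" for S
    by (induction S rule: infinite_finite_induct)
       (simp_all add: keys_add_monomials keys_mult_monomials monom_value_def prod)
  then have "\<beta> \<in> carrier (mpoly_ring P)" by (simp add: \<beta>_def subst_def)
  moreover have "poly_eval c \<beta> = poly_eval (\<lambda>x. if x \<in> P then c x else b x) \<alpha>" for c
  proof -
    have "poly_eval c \<beta> = subst (\<lambda>x. poly_eval c (Poly_Mapping.single 0 x)) (\<lambda>x. poly_eval c (g x)) \<alpha>"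
      unfolding \<beta>_def by (rule subst_comp_hom)
        (simp_all add: poly_eval_eq_subst eval.subst_add eval.subst_mult)
    moreover have "(\<lambda>x. poly_eval c (g x)) = (\<lambda>x. if x \<in> P then c x else b x)"
      by (auto simp: g_def poly_eval_eq_subst eval.subst_single monom_value_def)
    ultimately show ?thesis by (simp add: poly_eval_eq_subst eval.subst_single)
  qed
  ultimately show ?thesis by blast
qed

theorem theorem1p1:
  fixes n p :: nat
    and I :: "(nat, 'k::field) mpol set"
    and \<tau> :: "(nat \<Rightarrow>\<^sub>0 nat) rel"
  assumes "infinite (UNIV :: 'k set)"
    and "homogeneous_ideal {..<n} I"
    and "p \<le> n"
    and "term_order {..<n} \<tau>"
  shows "\<exists>U :: (nat \<Rightarrow> (nat, 'k) mpol) set.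
           zariski_open n p U \<and> U \<noteq> {} \<and>
           (\<forall>y\<in>U. \<forall>J. J = Idl\<^bsub>mpoly_ring {..<n}\<^esub> (y ` {..<p}) \<longrightarrow>
              (\<forall>j. hilbert_function {..<n} (I <+>\<^bsub>mpoly_ring {..<n}\<^esub> J) j
                 \<le> hilbert_function {..<n} (initial_ideal {..<n} \<tau> I <+>\<^bsub>mpoly_ring {..<n}\<^esub> J) j))"
proof -
  interpret standard_monomial_order n \<tau>
    by unfold_locales (use assms(4) in auto)
  let ?R = "mpoly_ring {..<n} :: (nat, 'k) mpol ring"
  interpret R: cring ?R by (rule cring_mpoly_ring)
  have I: "ideal I ?R" using assms(2) by (simp add: homogeneous_ideal_def)
  define P where "P = {..<p} \<times> {..<n}"
  obtain \<alpha> :: "'k param" where \<alpha>: "\<alpha> \<noteq> 0"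
    "\<And>a A j. poly_eval a \<alpha> \<noteq> 0 \<Longrightarrow> ideal A ?R \<Longrightarrow> I \<subseteq> A \<Longrightarrow>
     (\<And>i. i < p \<Longrightarrow> specialize a (generic_form n i) \<in> A) \<Longrightarrow>
     lead_set \<tau> (generic_module n I p j) \<subseteq> lead_set \<tau> (A \<inter> graded_piece {..<n} j)"
    using generic_lead_set_specializes[of I p] by blast
  obtain b where b: "poly_eval b \<alpha> \<noteq> 0" using exists_nonvanishing_point[OF assms(1) \<alpha>(1)] by blast
  obtain \<beta> where \<beta>: "\<beta> \<in> carrier (mpoly_ring P)"
    "\<And>c. poly_eval c \<beta> = poly_eval (\<lambda>x. if x \<in> P then c x else b x) \<alpha>"
    using exists_partial_evaluation[of P b \<alpha>] by blast
  define U where "U = {y \<in> linear_form_tuples n p. poly_eval (tuple_coord y) \<beta> \<noteq> 0}"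
  have "zariski_open n p U"
    unfolding zariski_open_def using \<beta>(1) by (intro exI[of _ "{\<beta>}"]) (auto simp: U_def P_def)
  moreover have "U \<noteq> {}"
  proof -
    define y0 where "y0 = (\<lambda>i\<in>{..<p}. \<Sum>k<n. Poly_Mapping.single (Poly_Mapping.single k (1::nat)) (b (i, k)))"
    have "y0 \<in> linear_form_tuples n p"
      unfolding linear_form_tuples_def y0_def using linear_form_in_graded_piece by (intro restrict_PiE_iff[THEN iffD2] ballI)
    moreover have "(\<lambda>x. if x \<in> P then tuple_coord y0 x else b x) = b"
    proof
      fix x show "(if x \<in> P then tuple_coord y0 x else b x) = b x"
        by (cases x) (simp add: P_def tuple_coord_def y0_def lookup_linear_form del: One_nat_def)
    qed
    ultimately have "y0 \<in> U" using b by (simp add: U_def \<beta>(2))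
    then show ?thesis by blast
  qed
  moreover have "hilbert_function {..<n} (I <+>\<^bsub>?R\<^esub> Idl\<^bsub>?R\<^esub> (y ` {..<p})) j
      \<le> hilbert_function {..<n} (initial_ideal {..<n} \<tau> I <+>\<^bsub>?R\<^esub> Idl\<^bsub>?R\<^esub> (y ` {..<p})) j"
    if "y \<in> U" for y j
  proof -
    let ?J = "Idl\<^bsub>?R\<^esub> (y ` {..<p})"
    let ?A = "I <+>\<^bsub>?R\<^esub> ?J" and ?B = "initial_ideal {..<n} \<tau> I <+>\<^bsub>?R\<^esub> ?J"
    let ?D = "degree_monomials {..<n} j"
    let ?LA = "lead_set \<tau> (?A \<inter> graded_piece {..<n} j)"
    let ?LB = "lead_set \<tau> (?B \<inter> graded_piece {..<n} j)"
    let ?L = "lead_set \<tau> (generic_module n I p j)"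
    have y: "y i \<in> graded_piece {..<n} 1" if "i < p" for i
      using \<open>y \<in> U\<close> that by (auto simp: U_def linear_form_tuples_def)
    have yR: "y ` {..<p} \<subseteq> carrier ?R" using y by (auto simp: graded_piece_def)
    have J: "ideal ?J ?R" by (rule R.genideal_ideal[OF yR])
    have A: "ideal ?A ?R" by (rule R.add_ideals[OF I J])
    have "{Poly_Mapping.single m 1 | f m. f \<in> I \<and> f \<noteq> 0 \<and> is_leading_monomial \<tau> f m} \<subseteq> carrier ?R"
      by (auto simp: is_leading_monomial_def dest: subsetD[OF ideal_in_carrier[OF I]])
    then have "ideal (initial_ideal {..<n} \<tau> I) ?R"
      unfolding initial_ideal_def by (rule R.genideal_ideal)
    then have B: "ideal ?B ?R" by (rule R.add_ideals[OF _ J])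
    have IA: "I \<subseteq> ?A"
    proof
      fix f assume "f \<in> I"
      then have "f + 0 \<in> ?A"
        unfolding set_add_def' add_mpoly_ring using ideal_zero[OF J] by blast
      then show "f \<in> ?A" by simp
    qed
    have JA: "y i \<in> ?A" if "i < p" for i
    proof -
      have "y i \<in> ?J" using R.genideal_self[OF yR] that by blast
      then have "0 + y i \<in> ?A"
        unfolding set_add_def' add_mpoly_ring using ideal_zero[OF I] by blast
      then show ?thesis by simp
    qed
    have LA: "?L \<subseteq> ?LA"
    proof (rule \<alpha>(2)[OF _ A IA])
      show "poly_eval (\<lambda>x. if x \<in> P then tuple_coord y x else b x) \<alpha> \<noteq> 0"
        using \<open>y \<in> U\<close> by (simp add: U_def \<beta>(2))
      show "specialize (\<lambda>x. if x \<in> P then tuple_coord y x else b x) (generic_form n i) \<in> ?A" if "i < p" for i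
      proof -
        have "specialize (\<lambda>x. if x \<in> P then tuple_coord y x else b x) (generic_form n i) = y i"
          by (rule specialize_generic_form[OF y[OF that]]) (simp add: P_def that tuple_coord_def)
        then show ?thesis using JA[OF that] by simp
      qed
    qed
    have LB: "card ?LB \<le> card ?L"
      by (rule card_lead_set_initial_le_generic[OF assms(1,2) y])
    have finD: "finite ?D" by (rule finite_degree_monomials) simp
    have LAD: "?LA \<subseteq> ?D" and LBD: "?LB \<subseteq> ?D" by (rule lead_set_subset)+
    have "card ?LB \<le> card ?LA"
      using LB card_mono[OF finite_subset[OF LAD finD] LA] by simp
    then have "card (?D - ?LA) \<le> card (?D - ?LB)"
      using LAD LBD finD by (simp add: card_Diff_subset finite_subset)
    then show ?thesis
      by (simp add: hilbert_function_eq_card_standard_monomials[OF A] hilbert_function_eq_card_standard_monomials[OF B])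
  qed
  ultimately show ?thesis by blast
qed

end
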